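(* Let $G=(V,E)$ be a graph of bounded degree and let $s\colon E\to\{-1,1\}$ be a sign function such that the signed voter model on $(G,s)$ has more than one equilibrium. Then there exists a subset $W\subset V$ such that the subgraph of $G$ induced on $W$ (that is, $W$ with its inherited edge set) contains no unsatisfied cycle and, for some starting site $x\in W$, the random walk on $G$ started at $x$ never leaves $W$ with strictly positive probability.
   Context: All graphs are simple, with countable vertex set and with every vertex $x$ of finite degree $d(x)\ge1$; bounded degree means $\sup_{x\in V}d(x)<\infty$. Given $G=(V,E)$ and $s\colon E\to\{-1,1\}$ (write $s(x,y)=s(\{x,y\})$), the signed voter model $(\eta_t)_{t\ge0}$ is the spin system on $\{-1,1\}^V$ with generator $$\Omega f(\eta)=\sum_{x\in V}\big(f(\eta^x)-f(\eta)\big)\frac1{d(x)}\sum_{y\colon\{x,y\}\in E}1\{\eta(x)\eta(y)\ne s(x,y)\},$$ where $\eta^x$ is $\eta$ with the spin at $x$ flipped. An equilibrium is an invariant probability measure of this process. The random walk on $G$ is the continuous-time walk which jumps from $x$ to each neighbour of $x$ at rate $1/d(x)$. An unsatisfied cycle is a nearest neighbour cycle (closed nearest neighbour path) along which the number of steps crossing an edge of sign $-1$ is odd. *)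

theory Defs
  imports "HOL-Probability.Probability"
begin

text \<open>
  The vertex set is the universe of a countable type; a graph on it is given by its set of edges,
  which are two-element sets of vertices.
\<close>

definition nbrs :: "'v set set \<Rightarrow> 'v \<Rightarrow> 'v set" where
  "nbrs E x = {y. {x, y} \<in> E}"

definition deg :: "'v set set \<Rightarrow> 'v \<Rightarrow> nat" where
  "deg E x = card (nbrs E x)"

definition locally_finite_graph :: "'v::countable set set \<Rightarrow> bool" where
  "locally_finite_graph E \<longleftrightarrow> (\<forall>e\<in>E. card e = 2) \<and> (\<forall>x. finite (nbrs E x) \<and> deg E x \<ge> 1)"

definition bounded_degree :: "'v set set \<Rightarrow> bool" where
  "bounded_degree E \<longleftrightarrow> bdd_above (range (deg E))"

definition induced_edges :: "'v set set \<Rightarrow> 'v set \<Rightarrow> 'v set set" where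
  "induced_edges E W = {e \<in> E. e \<subseteq> W}"

text \<open>A closed path is the list of its successive vertices, with the starting point repeated
  at the end.\<close>

definition closed_path :: "'v set set \<Rightarrow> 'v list \<Rightarrow> bool" where
  "closed_path E p \<longleftrightarrow>
     p \<noteq> [] \<and> hd p = last p \<and> (\<forall>i<length p - 1. {p ! i, p ! Suc i} \<in> E)"

definition unsatisfied_cycle :: "'v set set \<Rightarrow> ('v set \<Rightarrow> int) \<Rightarrow> 'v list \<Rightarrow> bool" where
  "unsatisfied_cycle E s p \<longleftrightarrow>
     closed_path E p \<and> odd (card {i. i < length p - 1 \<and> s {p ! i, p ! Suc i} = -1})"

text \<open>
  Configurations in \<open>{-1, 1}\<^sup>V\<close> are represented by functions into \<^typ>\<open>bool\<close>, which carries the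
  discrete topology; \<open>spin\<close> translates a Boolean to the spin it stands for. The function type
  carries the product topology, so it is a compact space and its bounded continuous functions
  form the Banach space \<open>C({-1, 1}\<^sup>V)\<close> with the supremum norm.
\<close>

definition spin :: "bool \<Rightarrow> int" where
  "spin b = (if b then 1 else -1)"

definition flip :: "'v \<Rightarrow> ('v \<Rightarrow> bool) \<Rightarrow> ('v \<Rightarrow> bool)" where
  "flip x \<eta> = \<eta>(x := \<not> \<eta> x)"

definition flip_rate :: "'v set set \<Rightarrow> ('v set \<Rightarrow> int) \<Rightarrow> 'v \<Rightarrow> ('v \<Rightarrow> bool) \<Rightarrow> real" where
  "flip_rate E s x \<eta> =
     1 / real (deg E x) * (\<Sum>y\<in>nbrs E x. of_bool (spin (\<eta> x) * spin (\<eta> y) \<noteq> s {x, y}))"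

definition voter_op ::
  "'v set set \<Rightarrow> ('v set \<Rightarrow> int) \<Rightarrow> (('v \<Rightarrow> bool) \<Rightarrow> real) \<Rightarrow> ('v \<Rightarrow> bool) \<Rightarrow> real" where
  "voter_op E s f \<eta> = (\<Sum>\<^sub>\<infinity>x. (f (flip x \<eta>) - f \<eta>) * flip_rate E s x \<eta>)"

definition cylinder :: "(('v \<Rightarrow> bool) \<Rightarrow> real) \<Rightarrow> bool" where
  "cylinder f \<longleftrightarrow> (\<exists>A. finite A \<and> (\<forall>\<eta> \<zeta>. (\<forall>x\<in>A. \<eta> x = \<zeta> x) \<longrightarrow> f \<eta> = f \<zeta>))"

text \<open>
  The graph of the operator on the cylinder functions, where the series in \<open>voter_op\<close> has only
  finitely many nonzero terms.
\<close>

definition voter_pregenerator ::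
  "'v set set \<Rightarrow> ('v set \<Rightarrow> int) \<Rightarrow> ((('v \<Rightarrow> bool) \<Rightarrow>\<^sub>C real) \<times> (('v \<Rightarrow> bool) \<Rightarrow>\<^sub>C real)) set" where
  "voter_pregenerator E s =
     {(f, g). cylinder (apply_bcontfun f) \<and> (\<forall>\<eta>. apply_bcontfun g \<eta> = voter_op E s (apply_bcontfun f) \<eta>)}"

text \<open>Markov (Feller) semigroups on \<open>C(X)\<close>; only times \<open>t \<ge> 0\<close> matter.\<close>

definition markov_semigroup ::
  "(real \<Rightarrow> ('x::topological_space \<Rightarrow>\<^sub>C real) \<Rightarrow> ('x \<Rightarrow>\<^sub>C real)) \<Rightarrow> bool" where
  "markov_semigroup S \<longleftrightarrow>
     (\<forall>t\<ge>0. linear (S t)) \<and>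
     (\<forall>f. S 0 f = f) \<and>
     (\<forall>t\<ge>0. \<forall>u\<ge>0. \<forall>f. S (t + u) f = S t (S u f)) \<and>
     (\<forall>f. \<forall>t\<ge>0. ((\<lambda>u. S u f) \<longlongrightarrow> S t f) (at_right t)) \<and>
     (\<forall>t\<ge>0. S t (const_bcontfun 1) = const_bcontfun 1) \<and>
     (\<forall>t\<ge>0. \<forall>f. (\<forall>\<eta>. apply_bcontfun f \<eta> \<ge> 0) \<longrightarrow> (\<forall>\<eta>. apply_bcontfun (S t f) \<eta> \<ge> 0))"

definition generator_graph ::
  "(real \<Rightarrow> ('x::topological_space \<Rightarrow>\<^sub>C real) \<Rightarrow> ('x \<Rightarrow>\<^sub>C real)) \<Rightarrow>
     (('x \<Rightarrow>\<^sub>C real) \<times> ('x \<Rightarrow>\<^sub>C real)) set" where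
  "generator_graph S = {(f, g). ((\<lambda>t. (S t f - f) /\<^sub>R t) \<longlongrightarrow> g) (at_right 0)}"

text \<open>
  By the Hille--Yosida theorem at most one semigroup has a given generator, so this predicate
  determines \<open>S\<close> at all times \<open>t \<ge> 0\<close>.
\<close>

definition signed_voter_semigroup ::
  "'v set set \<Rightarrow> ('v set \<Rightarrow> int) \<Rightarrow>
     (real \<Rightarrow> (('v \<Rightarrow> bool) \<Rightarrow>\<^sub>C real) \<Rightarrow> (('v \<Rightarrow> bool) \<Rightarrow>\<^sub>C real)) \<Rightarrow> bool" where
  "signed_voter_semigroup E s S \<longleftrightarrow>
     markov_semigroup S \<and> generator_graph S = closure (voter_pregenerator E s)"

definition invariant_prob ::
  "(real \<Rightarrow> ('x::topological_space \<Rightarrow>\<^sub>C real) \<Rightarrow> ('x \<Rightarrow>\<^sub>C real)) \<Rightarrow> 'x measure \<Rightarrow> bool" where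
  "invariant_prob S \<mu> \<longleftrightarrow>
     prob_space \<mu> \<and> sets \<mu> = sets borel \<and>
     (\<forall>t\<ge>0. \<forall>f. (\<integral>\<eta>. apply_bcontfun (S t f) \<eta> \<partial>\<mu>) = (\<integral>\<eta>. apply_bcontfun f \<eta> \<partial>\<mu>))"

text \<open>
  The continuous-time random walk, in its jump-chain/holding-time construction. The total jump
  rate out of each vertex is \<open>d(x) * (1 / d(x)) = 1\<close>. A sample point consists of independent
  \<open>a (n, x)\<close>, uniform on the neighbours of \<open>x\<close> (the vertex to which the \<open>n\<close>-th jump leads if it
  takes place at \<open>x\<close>), and of independent holding times \<open>h n\<close>, exponential with parameter 1.
\<close>

definition walk_space :: "'v set set \<Rightarrow> ((nat \<times> 'v \<Rightarrow> 'v) \<times> (nat \<Rightarrow> real)) measure" where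
  "walk_space E =
     (\<Pi>\<^sub>M (n, x)\<in>UNIV. measure_pmf (pmf_of_set (nbrs E x))) \<Otimes>\<^sub>M
     (\<Pi>\<^sub>M n\<in>UNIV. density lborel (exponential_density 1))"

primrec jump_chain :: "'v \<Rightarrow> (nat \<times> 'v \<Rightarrow> 'v) \<Rightarrow> nat \<Rightarrow> 'v" where
  "jump_chain x a 0 = x"
| "jump_chain x a (Suc n) = a (n, jump_chain x a n)"

text \<open>
  The number of jumps up to time \<open>t\<close>. The set is almost surely finite for all \<open>t\<close>; \<open>card\<close> returns 0
  on the null event that it is not.
\<close>

definition jump_count :: "(nat \<Rightarrow> real) \<Rightarrow> real \<Rightarrow> nat" where
  "jump_count h t = card {n. (\<Sum>i\<le>n. h i) \<le> t}"

definition random_walk :: "'v \<Rightarrow> real \<Rightarrow> (nat \<times> 'v \<Rightarrow> 'v) \<times> (nat \<Rightarrow> real) \<Rightarrow> 'v" where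
  "random_walk x t = (\<lambda>(a, h). jump_chain x a (jump_count h t))"

end

theory Submission
  imports Defs
begin

text \<open>
  If there is more than one equilibrium, then there is a nonzero bounded function \<open>h\<close> on the vertices
  that is signed harmonic: \<open>h(x)\<close> is the average of \<open>s(x,y) h(y)\<close> over the neighbours \<open>y\<close> of \<open>x\<close>. Given
  \<open>h\<close> with \<open>sup \<bar>h\<bar> = c\<close> and a bound \<open>D\<close> on the degrees, let \<open>W\<close> be the set where \<open>\<bar>h\<bar> > c (1 - 1/D)\<close>. At a
  vertex of \<open>W\<close> no term of the average can have the wrong sign (\<open>near_maximum_signs_agree\<close>), so the sign
  of \<open>h\<close> is multiplied by \<open>s(x,y)\<close> along every edge inside \<open>W\<close>, and a closed path in \<open>W\<close> crosses an even
  number of negative edges. On the other hand \<open>\<bar>h\<bar>\<close> is subharmonic, so \<open>(c - \<bar>h\<bar>) D / c\<close> is a nonnegative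
  superharmonic function that is at least \<open>1\<close> outside \<open>W\<close>. By optional stopping it bounds the probability
  of ever leaving \<open>W\<close>, and it is less than \<open>1\<close> in \<open>W\<close> (\<open>stay_forever_probability_ge\<close>).

  To find \<open>h\<close>, let \<open>F(A)\<close> be the difference of the expectations of \<open>\<Prod>\<^sub>x\<^sub>\<in>\<^sub>A \<eta>(x)\<close> under two equilibria. The
  generator maps such products to combinations of them (\<open>voter_op_spin_product\<close>), and invariance
  becomes the statement that \<open>F\<close> is harmonic for annihilating random walks which collect the signs of
  the edges that they cross (\<open>invariant_correlations\<close>). These products separate measures
  (\<open>prob_eqI_spin_products\<close>), so \<open>F\<close> is not zero. For a set \<open>A\<close> of least cardinality \<open>n\<close> with \<open>F(A) \<noteq> 0\<close>,
  the function \<open>F\<close> becomes a bounded nonzero function of \<open>n\<close> labelled particles that is zero at collisions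
  and harmonic elsewhere. Its iterates under the motion of independent particles converge to a
  nonzero function that is harmonic everywhere (\<open>harmonic_limit\<close>). Since the motions of different
  particles commute, a bounded harmonic function of all of them is harmonic in each single particle
  (\<open>commuting_averages_harmonic\<close>). Fixing the positions of all particles but one yields \<open>h\<close>.
\<close>

section \<open>Bounded harmonic functions of averaging operators\<close>

text \<open>
  The iterates \<open>Q\<^sup>k H\<close> converge to \<open>G\<close>. Indeed \<open>Q H - H\<close> lives where \<open>H\<close> vanishes, which gives
  \<open>\<bar>Q H - H\<bar> \<le> Q' \<bar>H\<bar> - \<bar>H\<bar>\<close>; so the increments of \<open>Q\<^sup>k H\<close> are dominated by those of \<open>Q'\<^sup>k \<bar>H\<bar>\<close>,
  an increasing sequence bounded by \<open>C\<close>. The final estimate says that \<open>G\<close> is close to \<open>H\<close> wherever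
  \<open>\<bar>H\<bar>\<close> is close to \<open>C\<close>, and is what shows that \<open>G\<close> is nonzero when \<open>C\<close> is the supremum of \<open>\<bar>H\<bar>\<close>.
\<close>

lemma harmonic_limit:
  fixes Q Q' :: "('z \<Rightarrow> real) \<Rightarrow> 'z \<Rightarrow> real" and H :: "'z \<Rightarrow> real"
  assumes Q_diff: "\<And>f g z. Q (\<lambda>z. f z - g z) z = Q f z - Q g z"
    and Q_lim: "\<And>f g z. (\<And>z. (\<lambda>k. f k z) \<longlonglongrightarrow> g z) \<Longrightarrow> (\<lambda>k. Q (f k) z) \<longlonglongrightarrow> Q g z"
    and dom: "\<And>f z. \<bar>Q f z\<bar> \<le> Q' (\<lambda>z. \<bar>f z\<bar>) z"
    and Q'_diff: "\<And>f g z. Q' (\<lambda>z. f z - g z) z = Q' f z - Q' g z"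
    and Q'_mono: "\<And>f g z. (\<And>z. f z \<le> g z) \<Longrightarrow> Q' f z \<le> Q' g z"
    and Q'_const: "\<And>c z. Q' (\<lambda>_. c) z = c"
    and H_bound: "\<And>z. \<bar>H z\<bar> \<le> C"
    and H_harmonic: "\<And>z. H z \<noteq> 0 \<Longrightarrow> Q H z = H z"
  obtains G where "\<And>z. Q G z = G z" and "\<And>z. \<bar>G z - H z\<bar> \<le> C - \<bar>H z\<bar>"
proof -
  define a where "a k = (Q ^^ k) H" for k
  define b where "b k = (Q' ^^ k) (\<lambda>z. \<bar>H z\<bar>)" for k
  have a_Suc: "a (Suc k) = Q (a k)" and b_Suc: "b (Suc k) = Q' (b k)" for k
    by (simp_all add: a_def b_def)
  have incr: "\<bar>a (Suc k) z - a k z\<bar> \<le> b (Suc k) z - b k z" for k z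
  proof (induction k arbitrary: z)
    case 0
    show ?case
      using dom[of H z] H_harmonic[of z] by (cases "H z = 0") (simp_all add: a_def b_def)
  next
    case (Suc k)
    have "\<bar>a (Suc (Suc k)) z - a (Suc k) z\<bar> = \<bar>Q (\<lambda>z. a (Suc k) z - a k z) z\<bar>"
      by (simp add: a_Suc Q_diff)
    also have "\<dots> \<le> Q' (\<lambda>z. \<bar>a (Suc k) z - a k z\<bar>) z"
      by (rule dom)
    also have "\<dots> \<le> Q' (\<lambda>z. b (Suc k) z - b k z) z"
      by (rule Q'_mono) (rule Suc.IH)
    also have "\<dots> = b (Suc (Suc k)) z - b (Suc k) z"
      by (simp add: b_Suc Q'_diff)
    finally show ?case .
  qed
  have b_le: "b k z \<le> C" for k z
  proof (induction k arbitrary: z)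
    case 0
    show ?case using H_bound by (simp add: b_def)
  next
    case (Suc k)
    have "b (Suc k) z \<le> Q' (\<lambda>_. C) z"
      unfolding b_Suc by (rule Q'_mono) (rule Suc.IH)
    then show ?case by (simp add: Q'_const)
  qed
  have dist: "\<bar>a k z - H z\<bar> \<le> b k z - \<bar>H z\<bar>" for k z
  proof (induction k)
    case 0
    show ?case by (simp add: a_def b_def)
  next
    case (Suc k)
    show ?case using incr[of k z] Suc.IH by linarith
  qed
  have "convergent (\<lambda>k. a k z)" for z
  proof -
    \<comment> \<open>The domination makes \<open>a + b\<close> monotone, so \<open>a\<close> converges as a difference of monotone sequences.\<close>
    have "b k z \<le> b (Suc k) z" and "a k z + b k z \<le> a (Suc k) z + b (Suc k) z" for k
      using incr[of k z] by linarith+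
    then have mono_b: "incseq (\<lambda>k. b k z)" and mono_ab: "incseq (\<lambda>k. a k z + b k z)"
      by (simp_all add: incseq_Suc_iff)
    obtain l where l: "(\<lambda>k. b k z) \<longlonglongrightarrow> l"
      by (rule incseq_convergent[OF mono_b]) (use b_le in auto)
    have "a k z + b k z \<le> 3 * C" for k
      using dist[of k z] b_le[of k z] H_bound[of z] by linarith
    then obtain l' where l': "(\<lambda>k. a k z + b k z) \<longlonglongrightarrow> l'"
      by (rule incseq_convergent[OF mono_ab, rule_format])
    from tendsto_diff[OF l' l] have "(\<lambda>k. a k z) \<longlonglongrightarrow> l' - l"
      by simp
    then show ?thesis
      by (rule convergentI)
  qed
  then have lim: "(\<lambda>k. a k z) \<longlonglongrightarrow> lim (\<lambda>k. a k z)" for z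
    by (simp add: convergent_LIMSEQ_iff)
  show thesis
  proof (rule that[of "\<lambda>z. lim (\<lambda>k. a k z)"])
    fix z
    have "(\<lambda>k. a (Suc k) z) \<longlonglongrightarrow> Q (\<lambda>z. lim (\<lambda>k. a k z)) z"
      unfolding a_Suc by (rule Q_lim) (rule lim)
    then show "Q (\<lambda>z. lim (\<lambda>k. a k z)) z = lim (\<lambda>k. a k z)"
      using LIMSEQ_Suc[OF lim[of z]] by (rule LIMSEQ_unique)
    show "\<bar>lim (\<lambda>k. a k z) - H z\<bar> \<le> C - \<bar>H z\<bar>"
    proof (rule LIMSEQ_le_const2)
      show "(\<lambda>k. \<bar>a k z - H z\<bar>) \<longlonglongrightarrow> \<bar>lim (\<lambda>k. a k z) - H z\<bar>"
        by (intro tendsto_intros lim)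
      have "\<bar>a k z - H z\<bar> \<le> C - \<bar>H z\<bar>" for k
        using dist[of k z] b_le[of k z] by linarith
      then show "\<exists>N. \<forall>k\<ge>N. \<bar>a k z - H z\<bar> \<le> C - \<bar>H z\<bar>"
        by blast
    qed
  qed
qed

text \<open>
  A bounded function that is harmonic for the mean of commuting contractions \<open>P\<^sub>k\<close> is harmonic for
  each of them; this is the argument behind the Choquet--Deny theorem. The function \<open>g = P\<^sub>i G - G\<close>
  is again harmonic for the mean. If \<open>\<bar>g\<bar>\<close> had a supremum \<open>c > 0\<close>, then at a point where \<open>g\<close>, up to
  sign, is almost \<open>c\<close>, all the terms of the mean are almost \<open>c\<close>, in particular \<open>P\<^sub>i g\<close>, and by
  iteration so are \<open>P\<^sub>i g\<close>, ..., \<open>P\<^sub>i\<^sup>N g\<close> for any fixed \<open>N\<close>. But the sum of \<open>g\<close>, ..., \<open>P\<^sub>i\<^sup>N\<^sup>-\<^sup>1 g\<close>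
  telescopes to \<open>P\<^sub>i\<^sup>N G - G\<close>, which is bounded independently of \<open>N\<close>.
\<close>

lemma commuting_averages_harmonic:
  fixes P :: "'i \<Rightarrow> ('z \<Rightarrow> real) \<Rightarrow> 'z \<Rightarrow> real" and G :: "'z \<Rightarrow> real"
  assumes P_diff: "\<And>i f g. P i (\<lambda>z. f z - g z) = (\<lambda>z. P i f z - P i g z)"
    and P_scale: "\<And>i c f. P i (\<lambda>z. c * f z) = (\<lambda>z. c * P i f z)"
    and P_sum: "\<And>i (f :: 'i \<Rightarrow> 'z \<Rightarrow> real). P i (\<lambda>z. \<Sum>k\<in>I. f k z) = (\<lambda>z. \<Sum>k\<in>I. P i (f k) z)"
    and P_bound: "\<And>i f c z. (\<And>z. \<bar>f z\<bar> \<le> c) \<Longrightarrow> \<bar>P i f z\<bar> \<le> c"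
    and P_comm: "\<And>i j f. i \<in> I \<Longrightarrow> j \<in> I \<Longrightarrow> P i (P j f) = P j (P i f)"
    and fin: "finite I" and i: "i \<in> I"
    and G_bound: "\<And>z. \<bar>G z\<bar> \<le> C"
    and G_harmonic: "\<And>z. real (card I) * G z = (\<Sum>k\<in>I. P k G z)"
  shows "P i G z = G z"
proof (rule ccontr)
  define harmonic where "harmonic f \<longleftrightarrow> (\<forall>z. real (card I) * f z = (\<Sum>k\<in>I. P k f z))"
    for f :: "'z \<Rightarrow> real"
  have harmonic_P: "harmonic (P i f)" if "harmonic f" for f
  proof -
    have "real (card I) * P i f z = (\<Sum>k\<in>I. P k (P i f) z)" for z
    proof -
      have "real (card I) * P i f z = P i (\<lambda>z. real (card I) * f z) z"
        by (simp add: P_scale)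
      also have "(\<lambda>z. real (card I) * f z) = (\<lambda>z. \<Sum>k\<in>I. P k f z)"
        using that by (auto simp: harmonic_def)
      also have "P i \<dots> z = (\<Sum>k\<in>I. P i (P k f) z)"
        by (simp add: P_sum)
      also have "\<dots> = (\<Sum>k\<in>I. P k (P i f) z)"
        by (intro sum.cong refl) (simp add: P_comm i)
      finally show ?thesis .
    qed
    then show ?thesis by (simp add: harmonic_def)
  qed
  define g where "g j = (P i ^^ j) (\<lambda>z. P i G z - G z)" for j
  have g_0: "g 0 = (\<lambda>z. P i G z - G z)" and g_Suc: "g (Suc j) = P i (g j)" for j
    by (simp_all add: g_def)
  have "harmonic G"
    using G_harmonic by (simp add: harmonic_def)
  then have "harmonic (P i G)"
    by (rule harmonic_P)
  have g_harmonic: "harmonic (g j)" for j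
  proof (induction j)
    case 0
    show ?case
      using \<open>harmonic G\<close> \<open>harmonic (P i G)\<close>
      unfolding harmonic_def g_0 P_diff by (simp add: sum_subtractf right_diff_distrib)
  next
    case (Suc j)
    then show ?case unfolding g_Suc by (rule harmonic_P)
  qed
  have g_eq: "g j = (\<lambda>z. (P i ^^ Suc j) G z - (P i ^^ j) G z)" for j
  proof (induction j)
    case 0
    show ?case by (simp add: g_0)
  next
    case (Suc j)
    show ?case unfolding g_Suc Suc.IH P_diff by simp
  qed
  have g_sum: "(\<Sum>j<N. g j z) = (P i ^^ N) G z - G z" for N z
    by (induction N) (simp_all add: g_eq)
  have P_G_bound: "\<bar>(P i ^^ N) G z\<bar> \<le> C" for N z
  proof (induction N arbitrary: z)
    case 0
    show ?case by (simp add: G_bound)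
  next
    case (Suc N)
    then show ?case by (simp add: P_bound)
  qed
  have g_sum_bound: "\<bar>\<Sum>j<N. g j z\<bar> \<le> 2 * C" for N z
    unfolding g_sum using G_bound[of z] P_G_bound[of N z] by linarith

  define c where "c = (SUP z. \<bar>g 0 z\<bar>)"
  have bdd: "bdd_above (range (\<lambda>z. \<bar>g 0 z\<bar>))"
    using g_sum_bound[where N = 1] by (auto intro!: bdd_aboveI[of _ "2 * C"])
  have g_le: "\<bar>g j z\<bar> \<le> c" for j z
  proof (induction j arbitrary: z)
    case 0
    show ?case unfolding c_def by (rule cSUP_upper[OF UNIV_I bdd])
  next
    case (Suc j)
    then show ?case unfolding g_Suc by (rule P_bound)
  qed
  assume "P i G z \<noteq> G z"
  then have "c > 0"
    using g_le[of 0 z] by (simp add: g_0)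
  define n where "n = real (card I)"
  have n: "n \<ge> 1"
    unfolding n_def using fin i by (auto simp: Suc_le_eq card_gt_0_iff)
  obtain N :: nat where N: "real N > 4 * C / c"
    using reals_Archimedean2 by blast
  \<comment> \<open>One application of \<open>P i\<close> enlarges the gap to \<open>c\<close> at most by the factor \<open>n\<close>; this \<open>\<epsilon>\<close> keeps it below \<open>c / 2\<close> for \<open>N\<close> steps.\<close>
  define \<epsilon> where "\<epsilon> = c / (2 * n ^ N)"
  have "\<epsilon> > 0"
    unfolding \<epsilon>_def using \<open>c > 0\<close> n by simp
  then have "\<exists>z. \<bar>g 0 z\<bar> > c - \<epsilon>"
    using less_cSUP_iff[OF _ bdd, of "c - \<epsilon>"] unfolding c_def by auto
  then obtain z where z: "\<bar>g 0 z\<bar> > c - \<epsilon>" ..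
  obtain \<sigma> :: real where \<sigma>: "\<bar>\<sigma>\<bar> = 1" and near: "\<sigma> * g 0 z \<ge> c - \<epsilon>"
  proof (cases "g 0 z \<ge> 0")
    case True
    then show thesis using that[of 1] z by simp
  next
    case False
    then show thesis using that[of "-1"] z by simp
  qed
  have stays: "\<sigma> * g j z \<ge> c - n ^ j * \<epsilon>" for j
  proof (induction j)
    case 0
    show ?case using near by simp
  next
    case (Suc j)
    have le: "\<sigma> * P k (g j) z \<le> c" for k
    proof -
      have "\<sigma> * P k (g j) z \<le> \<bar>\<sigma>\<bar> * \<bar>P k (g j) z\<bar>"
        by (metis abs_ge_self abs_mult)
      also have "\<dots> \<le> c" using P_bound[OF g_le] \<sigma> by simp
      finally show ?thesis .
    qed
    have "n * (\<sigma> * g j z) = \<sigma> * (\<Sum>k\<in>I. P k (g j) z)"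
      using g_harmonic[of j] by (simp add: harmonic_def n_def)
    also have "\<dots> = (\<Sum>k\<in>I. \<sigma> * P k (g j) z)"
      by (rule sum_distrib_left)
    also have "\<dots> = \<sigma> * P i (g j) z + (\<Sum>k\<in>I - {i}. \<sigma> * P k (g j) z)"
      by (rule sum.remove[OF fin i])
    also have "(\<Sum>k\<in>I - {i}. \<sigma> * P k (g j) z) \<le> (\<Sum>k\<in>I - {i}. c)"
      by (intro sum_mono le)
    also have "\<dots> = (n - 1) * c"
      using n fin i by (simp add: n_def of_nat_diff)
    finally have "\<sigma> * g (Suc j) z \<ge> n * (\<sigma> * g j z) - (n - 1) * c"
      by (simp add: g_Suc)
    moreover have "n * (\<sigma> * g j z) \<ge> n * (c - n ^ j * \<epsilon>)"
      using Suc.IH n by (intro mult_left_mono) auto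
    ultimately show ?case by (simp add: algebra_simps)
  qed
  have "c / 2 \<le> \<sigma> * g j z" if "j < N" for j
  proof -
    have "n ^ j * \<epsilon> \<le> n ^ N * \<epsilon>"
      using that n \<open>\<epsilon> > 0\<close> by (intro mult_right_mono power_increasing) auto
    also have "\<dots> = c / 2"
      unfolding \<epsilon>_def using n by simp
    finally show ?thesis using stays[of j] by linarith
  qed
  then have "(\<Sum>j<N. c / 2) \<le> (\<Sum>j<N. \<sigma> * g j z)"
    by (intro sum_mono) auto
  then have "N * (c / 2) \<le> \<sigma> * (\<Sum>j<N. g j z)"
    by (simp add: sum_distrib_left)
  also have "\<dots> \<le> \<bar>\<sigma>\<bar> * \<bar>\<Sum>j<N. g j z\<bar>"
    by (metis abs_ge_self abs_mult)
  also have "\<dots> \<le> 2 * C"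
    using g_sum_bound \<sigma> by simp
  finally show False
    using N \<open>c > 0\<close> by (simp add: field_simps)
qed

section \<open>Signed averages over neighbours\<close>

lemma nbrs_irrefl: "locally_finite_graph E \<Longrightarrow> y \<in> nbrs E x \<Longrightarrow> y \<noteq> x"
  by (auto simp: locally_finite_graph_def nbrs_def)

lemma finite_nbrs: "locally_finite_graph E \<Longrightarrow> finite (nbrs E x)"
  by (simp add: locally_finite_graph_def)

lemma deg_pos: "locally_finite_graph E \<Longrightarrow> deg E x > 0"
  by (auto simp: locally_finite_graph_def Suc_le_eq)

lemma sign_cases:
  assumes "s \<in> E \<rightarrow> {-1, 1}" and "y \<in> nbrs E x"
  shows "s {x, y} = 1 \<or> s {x, y} = -1"
  using assms by (auto simp: nbrs_def)

definition signed_avg :: "'v set set \<Rightarrow> ('v set \<Rightarrow> int) \<Rightarrow> ('v \<Rightarrow> real) \<Rightarrow> 'v \<Rightarrow> real" where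
  "signed_avg E s f x = (\<Sum>y\<in>nbrs E x. of_int (s {x, y}) * f y) / deg E x"

text \<open>The constant sign \<open>1\<close> gives the transition operator of the jump chain.\<close>

abbreviation avg :: "'v set set \<Rightarrow> ('v \<Rightarrow> real) \<Rightarrow> 'v \<Rightarrow> real" where
  "avg E \<equiv> signed_avg E (\<lambda>_. 1)"

lemma signed_avg_diff: "signed_avg E s (\<lambda>y. f y - g y) x = signed_avg E s f x - signed_avg E s g x"
  by (simp add: signed_avg_def right_diff_distrib sum_subtractf diff_divide_distrib)

lemma signed_avg_scale: "signed_avg E s (\<lambda>y. c * f y) x = c * signed_avg E s f x"
  by (simp add: signed_avg_def sum_distrib_left mult.left_commute)

lemma signed_avg_sum: "signed_avg E s (\<lambda>y. \<Sum>k\<in>I. f k y) x = (\<Sum>k\<in>I. signed_avg E s (f k) x)"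
  unfolding signed_avg_def sum_distrib_left
  by (subst sum.swap) (rule sum_divide_distrib)

lemma signed_avg_cong:
  assumes "\<And>y. y \<in> nbrs E x \<Longrightarrow> f y = g y"
  shows "signed_avg E s f x = signed_avg E s g x"
  using assms by (simp add: signed_avg_def)

lemma tendsto_signed_avg:
  assumes "\<And>y. ((\<lambda>k. f k y) \<longlongrightarrow> g y) F"
  shows "((\<lambda>k. signed_avg E s (f k) x) \<longlongrightarrow> signed_avg E s g x) F"
  unfolding signed_avg_def divide_inverse by (intro tendsto_intros assms)

lemma avg_mono: "(\<And>y. f y \<le> g y) \<Longrightarrow> avg E f x \<le> avg E g x"
  unfolding signed_avg_def by (simp add: divide_right_mono sum_mono)

lemma avg_const: "locally_finite_graph E \<Longrightarrow> avg E (\<lambda>_. c) x = c"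
  using deg_pos[of E x] by (simp add: signed_avg_def deg_def)

lemma abs_signed_avg_le:
  assumes "s \<in> E \<rightarrow> {-1, 1}"
  shows "\<bar>signed_avg E s f x\<bar> \<le> avg E (\<lambda>y. \<bar>f y\<bar>) x"
proof -
  have "\<bar>real_of_int (s {x, y}) * f y\<bar> = \<bar>f y\<bar>" if "y \<in> nbrs E x" for y
    using sign_cases[OF assms that] by auto
  then have "\<bar>\<Sum>y\<in>nbrs E x. real_of_int (s {x, y}) * f y\<bar> \<le> (\<Sum>y\<in>nbrs E x. \<bar>f y\<bar>)"
    by (intro order_trans[OF sum_abs] sum_mono) simp
  then show ?thesis
    by (simp add: signed_avg_def divide_right_mono)
qed

lemma abs_signed_avg_bound:
  assumes "locally_finite_graph E" and "s \<in> E \<rightarrow> {-1, 1}" and "\<And>y. \<bar>f y\<bar> \<le> c"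
  shows "\<bar>signed_avg E s f x\<bar> \<le> c"
proof -
  have "\<bar>signed_avg E s f x\<bar> \<le> avg E (\<lambda>y. \<bar>f y\<bar>) x"
    by (rule abs_signed_avg_le[OF assms(2)])
  also have "\<dots> \<le> avg E (\<lambda>_. c) x"
    by (rule avg_mono) (rule assms(3))
  finally show ?thesis
    by (simp add: avg_const[OF assms(1)])
qed

section \<open>Correlations of equilibria\<close>

definition spin_product :: "'v set \<Rightarrow> ('v \<Rightarrow> bool) \<Rightarrow> real" where
  "spin_product A \<eta> = (\<Prod>x\<in>A. of_int (spin (\<eta> x)))"

text \<open>
  A particle at \<open>x\<close> jumps to \<open>y\<close> and is annihilated together with a particle that it meets there. For
  \<open>x \<in> A\<close> and \<open>y \<noteq> x\<close> this is the symmetric difference of \<open>A\<close> and \<open>{x, y}\<close>;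
  pairs disappear because squares of spins are \<open>1\<close>.
\<close>

definition annihilating_move :: "'v set \<Rightarrow> 'v \<Rightarrow> 'v \<Rightarrow> 'v set" where
  "annihilating_move A x y = (if y \<in> A then A - {x, y} else insert y (A - {x}))"

lemma spin_product_empty [simp]: "spin_product {} \<eta> = 1"
  by (simp add: spin_product_def)

lemma abs_spin_product: "\<bar>spin_product A \<eta>\<bar> = 1"
  by (induction A rule: infinite_finite_induct) (simp_all add: spin_product_def abs_mult spin_def)

lemma continuous_spin_product: "continuous_on UNIV (spin_product A)"
proof -
  have "continuous_on UNIV (\<lambda>\<eta>. of_int (spin (\<eta> x)) :: real)" for x :: 'a
    by (rule continuous_on_compose2[of UNIV "\<lambda>b. of_int (spin b)" _ "\<lambda>\<eta>. \<eta> x"]) auto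
  then show ?thesis
    unfolding spin_product_def[abs_def] by (intro continuous_on_prod) auto
qed

lemma spin_product_bcontfun: "spin_product A \<in> bcontfun"
  by (rule bcontfun_normI[where b = 1]) (simp_all add: continuous_spin_product abs_spin_product)

lemma spin_product_flip:
  assumes "finite A"
  shows "spin_product A (flip x \<eta>) = (if x \<in> A then - spin_product A \<eta> else spin_product A \<eta>)"
proof -
  have "spin_product B (flip x \<eta>) = spin_product B \<eta>" if "x \<notin> B" for B
    unfolding spin_product_def using that by (intro prod.cong) (auto simp: flip_def)
  moreover have "spin_product A \<zeta> = of_int (spin (\<zeta> x)) * spin_product (A - {x}) \<zeta>" if "x \<in> A" for \<zeta>
    unfolding spin_product_def using assms that by (rule prod.remove)
  moreover have "spin (flip x \<eta> x) = - spin (\<eta> x)"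
    by (simp add: flip_def spin_def)
  ultimately show ?thesis by auto
qed

lemma spin_product_annihilating_move:
  assumes "finite A" and "x \<in> A" and "y \<noteq> x"
  shows "spin_product (annihilating_move A x y) \<eta>
    = of_int (spin (\<eta> x)) * of_int (spin (\<eta> y)) * spin_product A \<eta>"
proof -
  define \<xi> where "\<xi> z = (of_int (spin (\<eta> z)) :: real)" for z
  have sq: "\<xi> z * \<xi> z = 1" for z
    by (simp add: \<xi>_def spin_def)
  have rem: "spin_product B \<eta> = \<xi> z * spin_product (B - {z}) \<eta>" if "finite B" "z \<in> B" for B z
    unfolding spin_product_def \<xi>_def using that by (rule prod.remove)
  show ?thesis
  proof (cases "y \<in> A")
    case True
    have "spin_product A \<eta> = \<xi> x * (\<xi> y * spin_product (A - {x} - {y}) \<eta>)"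
      using assms True rem[of A x] rem[of "A - {x}" y] by simp
    then have "\<xi> x * \<xi> y * spin_product A \<eta>
        = (\<xi> x * \<xi> x) * (\<xi> y * \<xi> y) * spin_product (A - {x} - {y}) \<eta>"
      by (simp add: ac_simps)
    moreover have "A - {x, y} = A - {x} - {y}" by auto
    ultimately show ?thesis
      using True by (simp add: sq annihilating_move_def flip: \<xi>_def)
  next
    case False
    have "spin_product (insert y (A - {x})) \<eta> = \<xi> y * spin_product (A - {x}) \<eta>"
      using assms False by (simp add: spin_product_def \<xi>_def)
    moreover have "\<xi> x * \<xi> y * spin_product A \<eta> = (\<xi> x * \<xi> x) * (\<xi> y * spin_product (A - {x}) \<eta>)"
      using rem[of A x] assms by simp
    ultimately show ?thesis
      using False by (simp only: sq annihilating_move_def if_False flip: \<xi>_def)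
  qed
qed

text \<open>
  A flip at \<open>x \<in> A\<close> changes the sign of the spin product, and the indicator in the flip rate satisfies
  \<open>-2 * 1{\<eta>(x) \<eta>(y) \<noteq> s} = s \<eta>(x) \<eta>(y) - 1\<close>. Hence the operator maps spin products to combinations of
  spin products: this is the duality with annihilating random walks that carry the sign of the edges
  that they cross.
\<close>

lemma voter_op_spin_product:
  fixes E :: "'v::countable set set"
  assumes E: "locally_finite_graph E" and s: "s \<in> E \<rightarrow> {-1, 1}" and "finite A"
  shows "voter_op E s (spin_product A) \<eta>
    = (\<Sum>x\<in>A. signed_avg E s (\<lambda>y. spin_product (annihilating_move A x y) \<eta>) x - spin_product A \<eta>)"
proof -
  have "voter_op E s (spin_product A) \<eta>
      = (\<Sum>\<^sub>\<infinity>x\<in>A. (spin_product A (flip x \<eta>) - spin_product A \<eta>) * flip_rate E s x \<eta>)"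
    unfolding voter_op_def using \<open>finite A\<close>
    by (intro infsum_cong_neutral) (auto simp: spin_product_flip)
  also have "\<dots> = (\<Sum>x\<in>A. (spin_product A (flip x \<eta>) - spin_product A \<eta>) * flip_rate E s x \<eta>)"
    using \<open>finite A\<close> by (rule infsum_finite)
  also have "\<dots> = (\<Sum>x\<in>A. (\<Sum>y\<in>nbrs E x. of_int (s {x, y}) * spin_product (annihilating_move A x y) \<eta>)
        / deg E x - spin_product A \<eta>)"
  proof (intro sum.cong refl)
    fix x assume x: "x \<in> A"
    define p where "p = spin_product A \<eta>"
    have "- 2 * p * of_bool (spin (\<eta> x) * spin (\<eta> y) \<noteq> s {x, y})
        = of_int (s {x, y}) * spin_product (annihilating_move A x y) \<eta> - p" if y: "y \<in> nbrs E x" for y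
      unfolding spin_product_annihilating_move[OF \<open>finite A\<close> x nbrs_irrefl[OF E y]] p_def[symmetric]
      using sign_cases[OF s y]
      by (cases "\<eta> x"; cases "\<eta> y"; elim disjE) (simp_all add: spin_def)
    then have "(\<Sum>y\<in>nbrs E x. - 2 * p * of_bool (spin (\<eta> x) * spin (\<eta> y) \<noteq> s {x, y}))
        = (\<Sum>y\<in>nbrs E x. of_int (s {x, y}) * spin_product (annihilating_move A x y) \<eta>) - deg E x * p"
      by (simp add: sum_subtractf deg_def)
    then have eq: "- 2 * p * (\<Sum>y\<in>nbrs E x. of_bool (spin (\<eta> x) * spin (\<eta> y) \<noteq> s {x, y}))
        = (\<Sum>y\<in>nbrs E x. of_int (s {x, y}) * spin_product (annihilating_move A x y) \<eta>) - deg E x * p"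
      by (simp add: sum_distrib_left)
    have "(spin_product A (flip x \<eta>) - p) * flip_rate E s x \<eta>
        = (- 2 * p * (\<Sum>y\<in>nbrs E x. of_bool (spin (\<eta> x) * spin (\<eta> y) \<noteq> s {x, y}))) / deg E x"
      using x \<open>finite A\<close> by (simp add: spin_product_flip flip_rate_def p_def)
    also have "\<dots> = (\<Sum>y\<in>nbrs E x. of_int (s {x, y}) * spin_product (annihilating_move A x y) \<eta>)
        / deg E x - p"
      unfolding eq using deg_pos[OF E, of x] by (simp add: diff_divide_distrib)
    finally show "(spin_product A (flip x \<eta>) - spin_product A \<eta>) * flip_rate E s x \<eta>
      = (\<Sum>y\<in>nbrs E x. of_int (s {x, y}) * spin_product (annihilating_move A x y) \<eta>)
        / deg E x - spin_product A \<eta>"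
      by (simp add: p_def)
  qed
  finally show ?thesis
    unfolding signed_avg_def .
qed

lemma integrable_bcontfun:
  fixes f :: "'x::topological_space \<Rightarrow>\<^sub>C real"
  assumes "prob_space \<mu>" and "sets \<mu> = sets borel"
  shows "integrable \<mu> (apply_bcontfun f)"
proof -
  interpret prob_space \<mu> by fact
  have "apply_bcontfun f \<in> borel_measurable borel"
    by (intro borel_measurable_continuous_onI) simp
  then have "apply_bcontfun f \<in> borel_measurable \<mu>"
    using assms(2) measurable_cong_sets by blast
  then show ?thesis
    by (intro integrable_const_bound[where B = "norm f"]) (simp_all flip: real_norm_def add: norm_bounded)
qed

text \<open>
  Under an invariant measure the difference quotients of the semigroup have integral zero, and they
  converge uniformly.
\<close>

lemma integral_generator_eq_0:
  fixes S :: "real \<Rightarrow> ('x::topological_space \<Rightarrow>\<^sub>C real) \<Rightarrow> ('x \<Rightarrow>\<^sub>C real)"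
  assumes inv: "invariant_prob S \<mu>" and gen: "(f, g) \<in> generator_graph S"
  shows "(\<integral>\<eta>. apply_bcontfun g \<eta> \<partial>\<mu>) = 0"
proof -
  interpret prob_space \<mu>
    using inv by (simp add: invariant_prob_def)
  have int: "integrable \<mu> (apply_bcontfun h)" for h :: "'x \<Rightarrow>\<^sub>C real"
    using inv by (intro integrable_bcontfun) (simp_all add: invariant_prob_def)
  define q where "q t = (S t f - f) /\<^sub>R t" for t
  have q_0: "(\<integral>\<eta>. apply_bcontfun (q t) \<eta> \<partial>\<mu>) = 0" if "t > 0" for t
  proof -
    have "(\<integral>\<eta>. apply_bcontfun (q t) \<eta> \<partial>\<mu>)
        = inverse t * ((\<integral>\<eta>. apply_bcontfun (S t f) \<eta> \<partial>\<mu>) - (\<integral>\<eta>. apply_bcontfun f \<eta> \<partial>\<mu>))"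
      by (simp add: q_def int)
    then show ?thesis
      using inv that by (simp add: invariant_prob_def)
  qed
  have "(q \<longlongrightarrow> g) (at_right 0)"
    using gen by (simp add: generator_graph_def q_def[abs_def])
  then have lim: "((\<lambda>t. dist (q t) g) \<longlongrightarrow> 0) (at_right 0)"
    by (rule tendsto_dist_iff[THEN iffD1])
  have "\<bar>\<integral>\<eta>. apply_bcontfun g \<eta> \<partial>\<mu>\<bar> \<le> dist (q t) g" if "t > 0" for t
  proof -
    have "\<bar>\<integral>\<eta>. apply_bcontfun g \<eta> \<partial>\<mu>\<bar> = \<bar>\<integral>\<eta>. apply_bcontfun (q t - g) \<eta> \<partial>\<mu>\<bar>"
      using q_0[OF that] by (simp add: int)
    also have "\<dots> \<le> (\<integral>\<eta>. \<bar>apply_bcontfun (q t - g) \<eta>\<bar> \<partial>\<mu>)"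
      by (rule integral_abs_bound)
    also have "\<dots> \<le> (\<integral>\<eta>. dist (q t) g \<partial>\<mu>)"
      using norm_bounded[of "q t - g"]
      by (intro integral_mono integrable_abs int integrable_const) (simp add: dist_norm)
    also have "\<dots> = dist (q t) g"
      by (simp add: prob_space)
    finally show ?thesis .
  qed
  then have "\<forall>\<^sub>F t in at_right 0. \<bar>\<integral>\<eta>. apply_bcontfun g \<eta> \<partial>\<mu>\<bar> \<le> dist (q t) g"
    by (rule eventually_mono[OF eventually_at_right_less])
  then have "\<bar>\<integral>\<eta>. apply_bcontfun g \<eta> \<partial>\<mu>\<bar> \<le> 0"
    by (intro tendsto_lowerbound[OF lim]) auto
  then show ?thesis by simp
qed

lemma integrable_spin_product:
  fixes \<mu> :: "('v::countable \<Rightarrow> bool) measure"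
  assumes "prob_space \<mu>" and "sets \<mu> = sets borel"
  shows "integrable \<mu> (spin_product A)"
  using integrable_bcontfun[OF assms, of "Bcontfun (spin_product A)"]
  by (simp add: Bcontfun_inverse spin_product_bcontfun)

lemma invariant_correlations:
  fixes E :: "'v::countable set set"
  assumes E: "locally_finite_graph E" and s: "s \<in> E \<rightarrow> {-1, 1}" and "finite A"
    and S: "signed_voter_semigroup E s S" and inv: "invariant_prob S \<mu>"
  shows "real (card A) * (\<integral>\<eta>. spin_product A \<eta> \<partial>\<mu>)
    = (\<Sum>x\<in>A. signed_avg E s (\<lambda>y. \<integral>\<eta>. spin_product (annihilating_move A x y) \<eta> \<partial>\<mu>) x)"
proof -
  have \<mu>: "prob_space \<mu>" "sets \<mu> = sets borel"
    using inv by (simp_all add: invariant_prob_def)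
  note int = integrable_spin_product[OF \<mu>]
  define g where "g \<eta> = (\<Sum>x\<in>A. (\<Sum>y\<in>nbrs E x. of_int (s {x, y})
      * spin_product (annihilating_move A x y) \<eta>) / deg E x - spin_product A \<eta>)" for \<eta>
  have cont: "continuous_on UNIV g"
    unfolding g_def divide_inverse
    by (intro continuous_intros continuous_spin_product)
  have bound: "norm (g \<eta>) \<le> (\<Sum>x\<in>A. (\<Sum>y\<in>nbrs E x. \<bar>of_int (s {x, y})\<bar>) / deg E x + 1)" for \<eta>
  proof -
    have "\<bar>(\<Sum>y\<in>nbrs E x. of_int (s {x, y}) * spin_product (annihilating_move A x y) \<eta>) / deg E x\<bar>
        \<le> (\<Sum>y\<in>nbrs E x. \<bar>of_int (s {x, y})\<bar>) / deg E x" for x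
      unfolding abs_divide abs_of_nat
      by (intro divide_right_mono order_trans[OF sum_abs] sum_mono)
        (simp_all add: abs_mult abs_spin_product)
    then have "\<bar>(\<Sum>y\<in>nbrs E x. of_int (s {x, y}) * spin_product (annihilating_move A x y) \<eta>) / deg E x
        - spin_product A \<eta>\<bar> \<le> (\<Sum>y\<in>nbrs E x. \<bar>of_int (s {x, y})\<bar>) / deg E x + 1" for x
      by (rule order_trans[OF abs_triangle_ineq4 add_mono]) (simp add: abs_spin_product)
    then show ?thesis
      unfolding g_def real_norm_def by (intro order_trans[OF sum_abs] sum_mono)
  qed
  have "cylinder (spin_product A)"
    unfolding cylinder_def using \<open>finite A\<close>
    by (intro exI[of _ A]) (auto simp: spin_product_def intro!: prod.cong)
  moreover have "g \<in> bcontfun"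
    using cont bound by (rule bcontfun_normI)
  moreover have "g = voter_op E s (spin_product A)"
    by (rule ext) (simp add: g_def signed_avg_def voter_op_spin_product[OF E s \<open>finite A\<close>])
  ultimately have "(Bcontfun (spin_product A), Bcontfun g) \<in> voter_pregenerator E s"
    by (simp add: voter_pregenerator_def Bcontfun_inverse spin_product_bcontfun)
  then have "(Bcontfun (spin_product A), Bcontfun g) \<in> generator_graph S"
    using S closure_subset unfolding signed_voter_semigroup_def by blast
  then have "(\<integral>\<eta>. g \<eta> \<partial>\<mu>) = 0"
    using integral_generator_eq_0[OF inv, of _ "Bcontfun g"] \<open>g \<in> bcontfun\<close>
    by (simp add: Bcontfun_inverse)
  moreover have "(\<integral>\<eta>. g \<eta> \<partial>\<mu>) = (\<Sum>x\<in>A. (\<Sum>y\<in>nbrs E x. of_int (s {x, y})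
        * (\<integral>\<eta>. spin_product (annihilating_move A x y) \<eta> \<partial>\<mu>)) / deg E x
        - (\<integral>\<eta>. spin_product A \<eta> \<partial>\<mu>))"
    unfolding g_def by (simp add: int)
  ultimately show ?thesis
    by (simp add: sum_subtractf signed_avg_def)
qed

text \<open>
  Second countability of the spin space makes the Borel sets of the configuration space, for countably
  many sites, coincide with the product sigma-algebra.
\<close>

instance bool :: second_countable_topology
proof
  show "\<exists>B :: bool set set. countable B \<and> open = generate_topology B"
    by (intro exI[of _ UNIV] conjI ext)
      (simp_all add: Topological_Spaces.open_discrete generate_topology.Basis countable_finite)
qed

text \<open>
  On \<^typ>\<open>bool\<close> every function is affine in the spin, so the indicator of a cylinder set expands into a
  finite linear combination of spin products.
\<close>

lemma prob_eqI_spin_products: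
  fixes \<mu> \<nu> :: "('v::countable \<Rightarrow> bool) measure"
  assumes \<mu>: "prob_space \<mu>" "sets \<mu> = sets borel" and \<nu>: "prob_space \<nu>" "sets \<nu> = sets borel"
    and eq: "\<And>A. finite A \<Longrightarrow> (\<integral>\<eta>. spin_product A \<eta> \<partial>\<mu>) = (\<integral>\<eta>. spin_product A \<eta> \<partial>\<nu>)"
  shows "\<mu> = \<nu>"
proof (rule measure_eqI_PiM_infinite)
  show "sets \<mu> = sets (\<Pi>\<^sub>M x\<in>UNIV. borel)" and "sets \<nu> = sets (\<Pi>\<^sub>M x\<in>UNIV. borel)"
    using \<mu>(2) \<nu>(2) by (simp_all add: sets_PiM_equal_borel)
  show "finite_measure \<mu>"
    using \<mu>(1) by (rule prob_space.finite_measure)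
  fix J :: "'v set" and U :: "'v \<Rightarrow> bool set"
  assume "finite J"
  define box where "box = prod_emb UNIV (\<lambda>_. borel :: bool measure) J (Pi\<^sub>E J U)"
  have box_iff: "\<eta> \<in> box \<longleftrightarrow> (\<forall>x\<in>J. \<eta> x \<in> U x)" for \<eta>
    by (auto simp: box_def prod_emb_def)
  define \<alpha> where "\<alpha> x = (of_bool (True \<in> U x) + of_bool (False \<in> U x)) / (2 :: real)" for x
  define \<beta> where "\<beta> x = (of_bool (True \<in> U x) - of_bool (False \<in> U x)) / (2 :: real)" for x
  have affine: "of_bool (b \<in> U x) = \<beta> x * of_int (spin b) + \<alpha> x" for b x
    by (cases b) (simp_all add: \<alpha>_def \<beta>_def spin_def field_simps)
  have "indicator box \<eta> = (\<Prod>x\<in>J. of_bool (\<eta> x \<in> U x) :: real)" for \<eta>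
    using \<open>finite J\<close> by (auto simp: indicator_def box_iff prod_zero_iff)
  also have "\<dots> \<eta> = (\<Sum>B\<in>Pow J. (\<Prod>x\<in>B. \<beta> x) * (\<Prod>x\<in>J - B. \<alpha> x) * spin_product B \<eta>)" for \<eta>
    unfolding affine prod_add[OF \<open>finite J\<close>]
    by (simp add: spin_product_def prod.distrib ac_simps)
  finally have ind: "indicator box = (\<lambda>\<eta>.
      \<Sum>B\<in>Pow J. (\<Prod>x\<in>B. \<beta> x) * (\<Prod>x\<in>J - B. \<alpha> x) * spin_product B \<eta>)" ..
  have emeasure_box: "emeasure M box = ennreal (\<Sum>B\<in>Pow J. (\<Prod>x\<in>B. \<beta> x) * (\<Prod>x\<in>J - B. \<alpha> x)
      * (\<integral>\<eta>. spin_product B \<eta> \<partial>M))"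
    if M: "prob_space M" "sets M = sets borel" for M
  proof -
    interpret prob_space M by fact
    have "box \<in> sets (\<Pi>\<^sub>M x\<in>UNIV. borel :: bool measure)"
      unfolding box_def using \<open>finite J\<close> by (intro sets_PiM_I) (auto intro: borel_open Topological_Spaces.open_discrete)
    then have "box \<in> sets M"
      using M(2) by (simp add: sets_PiM_equal_borel)
    then have "measure M box = (\<integral>\<eta>. indicator box \<eta> \<partial>M)"
      by simp
    also have "\<dots> = (\<Sum>B\<in>Pow J. (\<Prod>x\<in>B. \<beta> x) * (\<Prod>x\<in>J - B. \<alpha> x)
        * (\<integral>\<eta>. spin_product B \<eta> \<partial>M))"
      unfolding ind by (simp add: integrable_spin_product[OF M])
    finally show ?thesis
      by (simp add: emeasure_eq_measure)
  qed
  show "emeasure \<mu> (prod_emb UNIV (\<lambda>_. borel) J (Pi\<^sub>E J U))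
      = emeasure \<nu> (prod_emb UNIV (\<lambda>_. borel) J (Pi\<^sub>E J U))"
  proof -
    have "(\<integral>\<eta>. spin_product B \<eta> \<partial>\<mu>) = (\<integral>\<eta>. spin_product B \<eta> \<partial>\<nu>)" if "B \<in> Pow J" for B
      using that \<open>finite J\<close> by (intro eq) (auto dest: finite_subset)
    then show ?thesis
      unfolding box_def[symmetric] emeasure_box[OF \<mu>] emeasure_box[OF \<nu>] by simp
  qed
qed

section \<open>From correlations to a signed harmonic function\<close>

text \<open>
  A function \<open>z\<close> of type \<open>'i \<Rightarrow> 'v\<close> is a placement of labelled particles, of which only those with
  label in a finite set \<open>I\<close> move. The average \<open>coord_avg\<close> moves one particle, and \<open>joint_avg\<close> a uniformly
  chosen one.
\<close>

definition coord_avg ::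
  "'v set set \<Rightarrow> ('v set \<Rightarrow> int) \<Rightarrow> 'i \<Rightarrow> (('i \<Rightarrow> 'v) \<Rightarrow> real) \<Rightarrow> ('i \<Rightarrow> 'v) \<Rightarrow> real" where
  "coord_avg E s i H z = signed_avg E s (\<lambda>y. H (z(i := y))) (z i)"

lemma coord_avg_commute:
  "coord_avg E s i (coord_avg E s j H) = coord_avg E s j (coord_avg E s i H)"
proof (cases "i = j")
  case False
  show ?thesis
  proof
    fix z
    have "coord_avg E s i (coord_avg E s j H) z =
        (\<Sum>x\<in>nbrs E (z i). \<Sum>y\<in>nbrs E (z j).
          of_int (s {z i, x}) * (of_int (s {z j, y}) * H (z(i := x, j := y)))) / deg E (z j) / deg E (z i)"
      using False by (simp add: coord_avg_def signed_avg_def sum_distrib_left sum_divide_distrib)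
    also have "\<dots> = (\<Sum>y\<in>nbrs E (z j). \<Sum>x\<in>nbrs E (z i).
          of_int (s {z j, y}) * (of_int (s {z i, x}) * H (z(j := y, i := x)))) / deg E (z i) / deg E (z j)"
      using False by (subst sum.swap) (simp add: fun_upd_twist mult.left_commute mult.commute)
    also have "\<dots> = coord_avg E s j (coord_avg E s i H) z"
      using False by (simp add: coord_avg_def signed_avg_def sum_distrib_left sum_divide_distrib)
    finally show "coord_avg E s i (coord_avg E s j H) z = coord_avg E s j (coord_avg E s i H) z" .
  qed
qed simp

definition joint_avg ::
  "'v set set \<Rightarrow> ('v set \<Rightarrow> int) \<Rightarrow> 'i set \<Rightarrow> (('i \<Rightarrow> 'v) \<Rightarrow> real) \<Rightarrow> ('i \<Rightarrow> 'v) \<Rightarrow> real" where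
  "joint_avg E s I H z = (\<Sum>i\<in>I. coord_avg E s i H z) / card I"

lemma joint_avg_diff:
  "joint_avg E s I (\<lambda>z. f z - g z) z = joint_avg E s I f z - joint_avg E s I g z"
  by (simp add: joint_avg_def coord_avg_def signed_avg_diff sum_subtractf diff_divide_distrib)

lemma abs_joint_avg_le:
  assumes "s \<in> E \<rightarrow> {-1, 1}"
  shows "\<bar>joint_avg E s I f z\<bar> \<le> joint_avg E (\<lambda>_. 1) I (\<lambda>z. \<bar>f z\<bar>) z"
  unfolding joint_avg_def coord_avg_def abs_divide abs_of_nat
  by (intro divide_right_mono order_trans[OF sum_abs] sum_mono abs_signed_avg_le[OF assms]) simp

text \<open>
  As \<open>F\<close> vanishes on sets with fewer points than \<open>A\<close>, a collision, which removes two particles, contributes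
  nothing. Up to the first collision the particles move independently, and the labelled version of \<open>F\<close>
  that is set to zero on colliding placements is harmonic wherever no collision has occurred.
\<close>

lemma collision_killed_harmonic:
  assumes E: "locally_finite_graph E" and A: "finite A" "A \<noteq> {}"
    and F: "\<And>B. finite B \<Longrightarrow> real (card B) * F B
      = (\<Sum>x\<in>B. signed_avg E s (\<lambda>y. F (annihilating_move B x y)) x)"
    and F_small: "\<And>B. finite B \<Longrightarrow> card B < card A \<Longrightarrow> F B = 0"
    and z: "inj_on z A"
  defines "H \<equiv> \<lambda>z. if inj_on z A then F (z ` A) else 0"
  shows "joint_avg E s A H z = H z"
proof -
  have move: "F (annihilating_move (z ` A) (z i) y) = H (z(i := y))" if i: "i \<in> A" and y: "y \<in> nbrs E (z i)" for i y
  proof (cases "y \<in> z ` A")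
    case True
    have "y \<noteq> z i"
      by (rule nbrs_irrefl[OF E y])
    then obtain j where j: "j \<in> A" "j \<noteq> i" "z j = y"
      using True by blast
    then have "\<not> inj_on (z(i := y)) A"
      using i inj_onD[of "z(i := y)" A i j] by auto
    moreover have "card (z ` A - {z i, y}) < card (z ` A)"
      using A i by (intro psubset_card_mono) auto
    then have "F (z ` A - {z i, y}) = 0"
      using A(1) z by (intro F_small) (auto simp: card_image)
    ultimately show ?thesis
      using True by (simp add: annihilating_move_def H_def)
  next
    case False
    then have "inj_on (z(i := y)) A"
      using z by (auto simp: inj_on_def)
    moreover have "z(i := y) ` A = insert y (z ` A - {z i})"
      using i z by (auto simp: inj_on_def)
    ultimately show ?thesis
      using False by (simp add: annihilating_move_def H_def)
  qed
  have "real (card A) * H z = real (card (z ` A)) * F (z ` A)"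
    using z by (simp add: H_def card_image)
  also have "\<dots> = (\<Sum>x\<in>z ` A. signed_avg E s (\<lambda>y. F (annihilating_move (z ` A) x y)) x)"
    using A(1) by (intro F) simp
  also have "\<dots> = (\<Sum>i\<in>A. signed_avg E s (\<lambda>y. F (annihilating_move (z ` A) (z i) y)) (z i))"
    by (simp add: sum.reindex[OF z])
  also have "\<dots> = (\<Sum>i\<in>A. coord_avg E s i H z)"
    unfolding coord_avg_def by (intro sum.cong refl signed_avg_cong move)
  finally show ?thesis
    using A by (simp add: joint_avg_def field_simps)
qed

text \<open>
  The function \<open>H\<close> of \<open>collision_killed_harmonic\<close> is turned into a nonzero function \<open>G\<close> that is harmonic
  for independent particles without killing (\<open>harmonic_limit\<close>). Such a function is harmonic in the
  position of each particle (\<open>commuting_averages_harmonic\<close>), so freezing all particles but one leaves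
  a signed harmonic function on the graph. The labels of the particles are the points of \<open>A\<close>, which
  makes the identity the placement with value \<open>F A\<close>.
\<close>

lemma nonzero_signed_harmonic_exists:
  fixes E :: "'v::countable set set" and F :: "'v set \<Rightarrow> real"
  assumes E: "locally_finite_graph E" and s: "s \<in> E \<rightarrow> {-1, 1}" and A: "finite A" "A \<noteq> {}"
    and F: "\<And>B. finite B \<Longrightarrow> real (card B) * F B
      = (\<Sum>x\<in>B. signed_avg E s (\<lambda>y. F (annihilating_move B x y)) x)"
    and F_small: "\<And>B. finite B \<Longrightarrow> card B < card A \<Longrightarrow> F B = 0"
    and F_bound: "\<And>B. \<bar>F B\<bar> \<le> b" and F_A: "F A \<noteq> 0"
  obtains h x c where "\<And>y. signed_avg E s h y = h y" and "\<And>y. \<bar>h y\<bar> \<le> c" and "h x \<noteq> 0"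
proof -
  define H where "H z = (if inj_on z A then F (z ` A) else 0)" for z :: "'v \<Rightarrow> 'v"
  define C where "C = (SUP z. \<bar>H z\<bar>)"
  have "b \<ge> 0"
    using F_bound[of A] by linarith
  then have bdd: "bdd_above (range (\<lambda>z. \<bar>H z\<bar>))"
    using F_bound by (intro bdd_aboveI[of _ b]) (auto simp: H_def)
  have H_le: "\<bar>H z\<bar> \<le> C" for z
    unfolding C_def by (rule cSUP_upper[OF UNIV_I bdd])
  have "H id \<noteq> 0"
    using F_A by (simp add: H_def)
  then have "C > 0"
    using H_le[of id] by linarith
  obtain G where G: "\<And>z. joint_avg E s A G z = G z" and G_near: "\<And>z. \<bar>G z - H z\<bar> \<le> C - \<bar>H z\<bar>"
  proof (rule harmonic_limit[where Q = "joint_avg E s A" and Q' = "joint_avg E (\<lambda>_. 1) A" and H = H and C = C])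
    show "joint_avg E s A H z = H z" if "H z \<noteq> 0" for z
    proof -
      have "inj_on z A"
        using that by (auto simp: H_def split: if_splits)
      from collision_killed_harmonic[OF E A F F_small this]
      show ?thesis by (simp add: H_def[abs_def])
    qed
    show "(\<lambda>k. joint_avg E s A (f k) z) \<longlonglongrightarrow> joint_avg E s A g z"
      if "\<And>z. (\<lambda>k. f k z) \<longlonglongrightarrow> g z" for f g z
      unfolding joint_avg_def coord_avg_def divide_inverse
      by (intro tendsto_intros tendsto_signed_avg that)
    show "joint_avg E (\<lambda>_. 1) A f z \<le> joint_avg E (\<lambda>_. 1) A g z" if "\<And>z. f z \<le> g z" for f g z
      unfolding joint_avg_def coord_avg_def by (intro divide_right_mono sum_mono avg_mono that) simp
    show "joint_avg E (\<lambda>_. 1) A (\<lambda>_. c) z = c" for c z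
      using A by (simp add: joint_avg_def coord_avg_def avg_const[OF E])
    fix G
    assume "\<And>z. joint_avg E s A G z = G z" and "\<And>z. \<bar>G z - H z\<bar> \<le> C - \<bar>H z\<bar>"
    then show thesis by (rule that)
  qed (use abs_joint_avg_le[OF s] H_le in \<open>simp_all add: joint_avg_diff\<close>)
  have G_le: "\<bar>G z\<bar> \<le> C" for z
    using G_near[of z] by linarith
  have "\<exists>z. \<bar>H z\<bar> > C / 2"
    using less_cSUP_iff[OF _ bdd, of "C / 2"] \<open>C > 0\<close> unfolding C_def[symmetric] by auto
  then obtain z where "\<bar>H z\<bar> > C / 2" ..
  then have "G z \<noteq> 0"
    using G_near[of z] by auto
  obtain i where i: "i \<in> A"
    using A by blast
  have G_coord: "coord_avg E s i G y = G y" for y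
  proof (rule commuting_averages_harmonic[where P = "coord_avg E s" and I = A and C = C])
    show "real (card A) * G z = (\<Sum>k\<in>A. coord_avg E s k G z)" for z
      using G[of z] A by (simp add: joint_avg_def field_simps)
    show "\<bar>coord_avg E s i f z\<bar> \<le> c" if "\<And>z. \<bar>f z\<bar> \<le> c" for i f c z
      unfolding coord_avg_def by (rule abs_signed_avg_bound[OF E s]) (rule that)
    show "coord_avg E s i (coord_avg E s j f) = coord_avg E s j (coord_avg E s i f)" for i j f
      by (rule coord_avg_commute)
    show "coord_avg E s i (\<lambda>z. f z - g z) = (\<lambda>z. coord_avg E s i f z - coord_avg E s i g z)" for i f g
      by (rule ext) (simp add: coord_avg_def signed_avg_diff)
    show "coord_avg E s i (\<lambda>z. c * f z) = (\<lambda>z. c * coord_avg E s i f z)" for i c f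
      by (rule ext) (simp add: coord_avg_def signed_avg_scale)
    show "coord_avg E s i (\<lambda>z. \<Sum>k\<in>A. f k z) = (\<lambda>z. \<Sum>k\<in>A. coord_avg E s i (f k) z)" for i and f :: "'v \<Rightarrow> _"
      by (rule ext) (simp add: coord_avg_def signed_avg_sum)
  qed (use A i G_le in simp_all)
  define h where "h y = G (z(i := y))" for y
  show thesis
  proof (rule that[of h C "z i"])
    show "signed_avg E s h y = h y" for y
      using G_coord[of "z(i := y)"] by (simp add: coord_avg_def h_def[abs_def])
    show "\<bar>h y\<bar> \<le> C" for y
      by (simp add: h_def G_le)
    show "h (z i) \<noteq> 0"
      using \<open>G z \<noteq> 0\<close> by (simp add: h_def)
  qed
qed

section \<open>The probability of never leaving a set\<close>

abbreviation jump_measure :: "'v set set \<Rightarrow> (nat \<times> 'v) set \<Rightarrow> (nat \<times> 'v \<Rightarrow> 'v) measure" where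
  "jump_measure E K \<equiv> (\<Pi>\<^sub>M (n, x)\<in>K. measure_pmf (pmf_of_set (nbrs E x)))"

text \<open>The jump chain that starts at time \<open>m\<close> uses the steps with time index at least \<open>m\<close>.\<close>

definition delay :: "nat \<Rightarrow> (nat \<times> 'v \<Rightarrow> 'v) \<Rightarrow> (nat \<times> 'v \<Rightarrow> 'v)" where
  "delay m a = (\<lambda>(n, x). a (m + n, x))"

lemma delay_apply [simp]: "delay m a (n, x) = a (m + n, x)"
  by (simp add: delay_def)

lemma delay_0 [simp]: "delay 0 a = a"
  by (rule ext) (simp add: delay_def case_prod_unfold)

lemma prob_space_jump_measure: "prob_space (jump_measure E K)"
  by (rule prob_space_PiM) (auto simp: prob_space_measure_pmf)

lemma jump_chain_first_step:
  "jump_chain x (delay m a) (Suc k) = jump_chain (a (m, x)) (delay (Suc m) a) k"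
  by (induction k) simp_all

lemma measurable_jump_component:
  assumes "i \<in> K"
  shows "(\<lambda>a. a i) \<in> measurable (jump_measure E K) (count_space UNIV)"
proof -
  define P where "P = (\<lambda>(n :: nat, x). measure_pmf (pmf_of_set (nbrs E x)))"
  have "sets (P i) = sets (count_space UNIV)"
    by (cases i) (simp add: P_def)
  then have "measurable (PiM K P) (count_space UNIV) = measurable (PiM K P) (P i)"
    by (intro measurable_cong_sets) simp_all
  then show ?thesis
    using measurable_component_singleton[OF assms, of P] by (simp add: P_def)
qed

lemma measurable_jump_chain:
  fixes E :: "'v::countable set set"
  assumes K: "{m..} \<times> UNIV \<subseteq> K"
  shows "(\<lambda>a. jump_chain x (delay m a) k) \<in> measurable (jump_measure E K) (count_space UNIV)"
proof (induction k)
  case 0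
  show ?case by simp
next
  case (Suc k)
  have "(\<lambda>a. a (m + k, v)) \<in> measurable (jump_measure E K) (count_space UNIV)" for v :: 'v
    using K by (intro measurable_jump_component) auto
  then have "(\<lambda>a. a (m + k, jump_chain x (delay m a) k)) \<in> measurable (jump_measure E K) (count_space UNIV)"
    by (rule measurable_compose_countable[where f = "\<lambda>v a. a (m + k, v)", OF _ Suc.IH])
  then show ?case
    by simp
qed

lemma measurable_undelayed_jump_chain:
  fixes E :: "'v::countable set set"
  shows "(\<lambda>a. jump_chain x a k) \<in> measurable (jump_measure E UNIV) (count_space UNIV)"
  using measurable_jump_chain[where m = 0 and K = UNIV] by simp

lemma sets_jump_chain_stays:
  fixes E :: "'v::countable set set"
  assumes "{m..} \<times> UNIV \<subseteq> K"
  shows "{a \<in> space (jump_measure E K). \<forall>k\<le>N. jump_chain x (delay m a) k \<in> W} \<in> sets (jump_measure E K)"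
proof -
  note [measurable] = measurable_jump_chain[OF assms, of x]
  show ?thesis by measurable
qed

text \<open>
  The first step of the chain that starts at time \<open>m\<close> is the coordinate \<open>(m, x)\<close>, whereas the chain that
  starts at time \<open>m + 1\<close> depends on the disjoint set of coordinates with larger time index.
\<close>

lemma first_step_independent:
  fixes E :: "'v::countable set set"
  assumes E: "locally_finite_graph E" and y: "y \<in> nbrs E x"
  defines "M \<equiv> jump_measure E UNIV"
  shows "measure M {a \<in> space M. a (m, x) = y \<and> (\<forall>k\<le>N. jump_chain y (delay (Suc m) a) k \<in> W)}
    = measure M {a \<in> space M. \<forall>k\<le>N. jump_chain y (delay (Suc m) a) k \<in> W} / deg E x"
proof -
  interpret prob_space M
    unfolding M_def by (rule prob_space_jump_measure)
  define P where "P = (\<lambda>(n :: nat, x). measure_pmf (pmf_of_set (nbrs E x)))"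
  have M: "M = PiM UNIV P"
    by (simp add: M_def P_def)
  have P: "prob_space (P i)" for i
    by (cases i) (simp add: P_def prob_space_measure_pmf)
  have coordinate: "(\<lambda>a. a i) \<in> measurable M (P i)" "distr M (P i) (\<lambda>a. a i) = P i" for i
    unfolding M by (simp_all add: distr_PiM_component P measurable_component_singleton)
  have "(\<lambda>a. \<lambda>i\<in>UNIV. a i) = (\<lambda>a :: nat \<times> 'v \<Rightarrow> 'v. a)"
    by (rule ext)+ simp
  then have "distr M (PiM UNIV P) (\<lambda>a. \<lambda>i\<in>UNIV. a i) = PiM UNIV (\<lambda>i. distr M (P i) (\<lambda>a. a i))"
    unfolding coordinate(2) by (simp add: M)
  then have indep: "indep_vars P (\<lambda>i a. a i) UNIV"
    by (subst indep_vars_iff_distr_eq_PiM) (simp_all add: coordinate)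
  define A where "A = {(m, x)}"
  define B :: "(nat \<times> 'v) set" where "B = {Suc m..} \<times> UNIV"
  have ind: "indep_var (PiM A P) (\<lambda>a. restrict (\<lambda>i. a i) A) (PiM B P) (\<lambda>a. restrict (\<lambda>i. a i) B)"
    by (rule indep_var_restrict[OF indep]) (auto simp: A_def B_def)
  define U where "U = {b \<in> space (PiM A P). b (m, x) = y}"
  define V where "V = {b \<in> space (PiM B P). \<forall>k\<le>N. jump_chain y (delay (Suc m) b) k \<in> W}"
  have "(\<lambda>b. b (m, x)) \<in> measurable (PiM A P) (P (m, x))"
    by (rule measurable_component_singleton) (simp add: A_def)
  then have "U \<in> sets (PiM A P)"
    unfolding U_def by (rule measurable_sets_Collect[where P = "\<lambda>v. v = y"]) (simp add: P_def)
  moreover have "V \<in> sets (PiM B P)"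
    unfolding V_def P_def by (rule sets_jump_chain_stays) (simp add: B_def)
  ultimately have "prob {a \<in> space M. restrict a A \<in> U \<and> restrict a B \<in> V}
      = prob {a \<in> space M. restrict a A \<in> U} * prob {a \<in> space M. restrict a B \<in> V}"
    using indep_varD[OF ind, of U V] by (simp add: vimage_def Int_def conj_commute)
  moreover have "restrict a A \<in> U \<longleftrightarrow> a (m, x) = y" if "a \<in> space M" for a
    using that by (auto simp: U_def A_def M space_PiM)
  moreover have "restrict a B \<in> V \<longleftrightarrow> (\<forall>k\<le>N. jump_chain y (delay (Suc m) a) k \<in> W)"
    if "a \<in> space M" for a
  proof -
    have "jump_chain y (delay (Suc m) (restrict a B)) k = jump_chain y (delay (Suc m) a) k" for k
      by (induction k) (simp_all add: B_def)
    then show ?thesis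
      using that by (auto simp: V_def M space_PiM)
  qed
  ultimately have "prob {a \<in> space M. a (m, x) = y \<and> (\<forall>k\<le>N. jump_chain y (delay (Suc m) a) k \<in> W)}
      = prob {a \<in> space M. a (m, x) = y} *
        prob {a \<in> space M. \<forall>k\<le>N. jump_chain y (delay (Suc m) a) k \<in> W}"
    by (simp cong: conj_cong)
  moreover have "prob {a \<in> space M. a (m, x) = y} = 1 / deg E x"
  proof -
    have "measure (distr M (P (m, x)) (\<lambda>a. a (m, x))) {y} = prob ((\<lambda>a. a (m, x)) -` {y} \<inter> space M)"
      using coordinate(1) by (rule measure_distr) (simp add: P_def)
    also have "(\<lambda>a. a (m, x)) -` {y} \<inter> space M = {a \<in> space M. a (m, x) = y}"
      by auto
    finally have "prob {a \<in> space M. a (m, x) = y} = measure (distr M (P (m, x)) (\<lambda>a. a (m, x))) {y}" ..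
    also have "distr M (P (m, x)) (\<lambda>a. a (m, x)) = P (m, x)"
      by (rule coordinate(2))
    also have "measure (P (m, x)) {y} = 1 / deg E x"
    proof -
      have "nbrs E x \<noteq> {}" "finite (nbrs E x)"
        using E y by (auto simp: locally_finite_graph_def)
      then show ?thesis
        using y by (simp add: P_def deg_def measure_pmf_single)
    qed
    finally show ?thesis .
  qed
  ultimately show ?thesis by simp
qed

text \<open>
  The probability of having left \<open>W\<close> within \<open>N\<close> steps is bounded by any nonnegative function that is at
  least \<open>1\<close> outside \<open>W\<close> and superharmonic in \<open>W\<close>, by induction on \<open>N\<close> with a decomposition according
  to the first step. The starting time \<open>m\<close> varies in the induction.
\<close>

lemma stay_probability_ge:
  fixes E :: "'v::countable set set"
  assumes E: "locally_finite_graph E"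
    and superharmonic: "\<And>x. x \<in> W \<Longrightarrow> avg E g x \<le> g x"
    and nonneg: "\<And>x. g x \<ge> (0 :: real)" and outside: "\<And>x. x \<notin> W \<Longrightarrow> g x \<ge> 1"
  defines "M \<equiv> jump_measure E UNIV"
  shows "measure M {a \<in> space M. \<forall>k\<le>N. jump_chain x (delay m a) k \<in> W} \<ge> 1 - g x"
proof (induction N arbitrary: m x)
  interpret prob_space M
    unfolding M_def by (rule prob_space_jump_measure)
  case 0
  show ?case
  proof (cases "x \<in> W")
    case True
    then show ?thesis using nonneg[of x] by (simp add: prob_space)
  next
    case False
    then have "1 - g x \<le> 0"
      using outside[of x] by simp
    then show ?thesis
      using measure_nonneg by (rule order_trans)
  qed
next
  interpret prob_space M
    unfolding M_def by (rule prob_space_jump_measure)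
  case (Suc N)
  define D where "D m y = {a \<in> space M. \<forall>k\<le>N. jump_chain y (delay m a) k \<in> W}" for m y
  define F where "F y = {a \<in> space M. a (m, x) = y \<and> (\<forall>k\<le>N. jump_chain y (delay (Suc m) a) k \<in> W)}" for y
  show ?case
  proof (cases "x \<in> W")
    case False
    then have "1 - g x \<le> 0"
      using outside[of x] by simp
    then show ?thesis
      using measure_nonneg by (rule order_trans)
  next
    case True
    have "(\<forall>k\<le>Suc N. jump_chain x (delay m a) k \<in> W)
        \<longleftrightarrow> (\<forall>k\<le>N. jump_chain (a (m, x)) (delay (Suc m) a) k \<in> W)" for a
      unfolding less_Suc_eq_le[symmetric] All_less_Suc2 jump_chain_first_step using True by simp
    then have eq: "{a \<in> space M. \<forall>k\<le>Suc N. jump_chain x (delay m a) k \<in> W}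
        = {a \<in> space M. a \<in> F (a (m, x))}"
      by (simp add: F_def)
    have [measurable]: "(\<lambda>a. a (m, x)) \<in> measurable M (count_space UNIV)"
      unfolding M_def by (rule measurable_jump_component) simp
    have sets_F: "F y \<in> sets M" for y
    proof -
      have [measurable]: "(\<lambda>a. jump_chain y (delay (Suc m) a) k) \<in> measurable M (count_space UNIV)" for k
        unfolding M_def by (rule measurable_jump_chain) simp
      show ?thesis unfolding F_def by measurable
    qed
    \<comment> \<open>For the neighbours \<open>y\<close>, the events \<open>F y\<close> are disjoint parts of the event of staying in \<open>W\<close>.\<close>
    have "1 - g x \<le> 1 - avg E g x"
      using superharmonic[OF True] by simp
    also have "\<dots> = (\<Sum>y\<in>nbrs E x. (1 - g y) / deg E x)"
    proof -
      have "deg E x \<noteq> 0"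
        using deg_pos[OF E, of x] by simp
      then show ?thesis
        by (simp add: signed_avg_def sum_subtractf deg_def diff_divide_distrib flip: sum_divide_distrib)
    qed
    also have "\<dots> \<le> (\<Sum>y\<in>nbrs E x. prob (D (Suc m) y) / deg E x)"
      unfolding D_def by (intro sum_mono divide_right_mono Suc.IH) simp
    also have "\<dots> = (\<Sum>y\<in>nbrs E x. prob (F y))"
      unfolding D_def F_def M_def by (intro sum.cong refl first_step_independent[OF E, symmetric])
    also have "\<dots> = prob (\<Union>y\<in>nbrs E x. F y)"
    proof (rule finite_measure_finite_Union[symmetric])
      show "finite (nbrs E x)"
        by (rule finite_nbrs[OF E])
      show "F ` nbrs E x \<subseteq> sets M"
        using sets_F by blast
      show "disjoint_family_on F (nbrs E x)"
        unfolding disjoint_family_on_def F_def by blast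
    qed
    also have "\<dots> \<le> prob {a \<in> space M. a \<in> F (a (m, x))}"
    proof (rule finite_measure_mono)
      have "{a \<in> space M. \<forall>k\<le>Suc N. jump_chain x (delay m a) k \<in> W} \<in> sets M"
        unfolding M_def by (rule sets_jump_chain_stays) simp
      then show "{a \<in> space M. a \<in> F (a (m, x))} \<in> sets M"
        unfolding eq .
      show "(\<Union>y\<in>nbrs E x. F y) \<subseteq> {a \<in> space M. a \<in> F (a (m, x))}"
        unfolding F_def by blast
    qed
    finally show ?thesis unfolding eq .
  qed
qed

lemma stay_forever_probability_ge:
  fixes E :: "'v::countable set set"
  assumes E: "locally_finite_graph E"
    and superharmonic: "\<And>x. x \<in> W \<Longrightarrow> avg E g x \<le> g x"
    and nonneg: "\<And>x. g x \<ge> (0 :: real)" and outside: "\<And>x. x \<notin> W \<Longrightarrow> g x \<ge> 1"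
  defines "M \<equiv> jump_measure E UNIV"
  shows "measure M {a \<in> space M. \<forall>k. jump_chain x a k \<in> W} \<ge> 1 - g x"
proof (rule LIMSEQ_le_const)
  interpret prob_space M
    unfolding M_def by (rule prob_space_jump_measure)
  define D where "D N = {a \<in> space M. \<forall>k\<le>N. jump_chain x a k \<in> W}" for N
  have "(\<lambda>N. measure M (D N)) \<longlonglongrightarrow> measure M (\<Inter>N. D N)"
  proof (rule finite_Lim_measure_decseq)
    have "D N \<in> sets M" for N
      using sets_jump_chain_stays[OF subset_UNIV, of E N x 0 W] unfolding D_def M_def delay_0 .
    then show "range D \<subseteq> sets M"
      by blast
    show "decseq D"
      unfolding decseq_def D_def by fastforce
  qed
  moreover have "(\<Inter>N. D N) = {a \<in> space M. \<forall>k. jump_chain x a k \<in> W}"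
    unfolding D_def by blast
  ultimately show "(\<lambda>N. measure M (D N)) \<longlonglongrightarrow> measure M {a \<in> space M. \<forall>k. jump_chain x a k \<in> W}"
    by simp
  have "1 - g x \<le> measure M (D N)" for N
    using stay_probability_ge[OF E superharmonic nonneg outside, where N = N and x = x and m = 0]
    unfolding D_def M_def delay_0 by blast
  then show "\<exists>N. \<forall>n\<ge>N. 1 - g x \<le> measure M (D n)"
    by blast
qed

abbreviation holding_measure :: "(nat \<Rightarrow> real) measure" where
  "holding_measure \<equiv> (\<Pi>\<^sub>M n\<in>UNIV. density lborel (exponential_density 1))"

text \<open>
  This replaces the uncountably many times \<open>t\<close> by countably many random times, as measurability requires.
  The number of jumps is constant between consecutive nonnegative jump times, so a value attained at \<open>t\<close>
  is attained at the last such jump time before \<open>t\<close>, or at time \<open>0\<close>. The natural numbers also account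
  for sample points with infinitely many jumps before \<open>t\<close>, where the count is \<open>0\<close> by convention.
\<close>

lemma jump_count_attained_iff:
  "(\<exists>t\<ge>0. jump_count h t = k) \<longleftrightarrow>
    (\<exists>n :: nat. jump_count h (real n) = k) \<or> (\<exists>m. (\<Sum>i\<le>m. h i) \<ge> 0 \<and> jump_count h (\<Sum>i\<le>m. h i) = k)"
proof
  assume "\<exists>t\<ge>0. jump_count h t = k"
  then obtain t where t: "t \<ge> 0" "jump_count h t = k" by blast
  define T where "T m = (\<Sum>i\<le>m. h i)" for m
  have count: "jump_count h u = card {m. T m \<le> u}" for u
    by (simp add: jump_count_def T_def)
  consider (inf) "infinite {m. T m \<le> t}" | (neg) "finite {m. T m \<le> t}" "\<forall>m. T m \<le> t \<longrightarrow> T m < 0"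
    | (pos) "finite {m. T m \<le> t}" "\<exists>m. T m \<le> t \<and> T m \<ge> 0"
    by force
  then show "(\<exists>n :: nat. jump_count h (real n) = k)
      \<or> (\<exists>m. (\<Sum>i\<le>m. h i) \<ge> 0 \<and> jump_count h (\<Sum>i\<le>m. h i) = k)"
  proof cases
    case inf
    obtain n :: nat where "t \<le> real n"
      using real_arch_simple by blast
    then have "{m. T m \<le> t} \<subseteq> {m. T m \<le> real n}"
      by auto
    then have "infinite {m. T m \<le> real n}"
      using inf by (rule infinite_super)
    then have "jump_count h (real n) = jump_count h t"
      using inf by (simp add: count)
    then show ?thesis using t by blast
  next
    case neg
    then have "{m. T m \<le> t} = {m. T m \<le> 0}"
      using t(1) by force
    then have "jump_count h (real 0) = k"
      using t(2) by (simp add: count)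
    then show ?thesis by blast
  next
    case pos
    define A where "A = {m. T m \<le> t \<and> T m \<ge> 0}"
    have "finite (T ` A)" "T ` A \<noteq> {}"
      using pos by (auto simp: A_def)
    then have "Max (T ` A) \<in> T ` A" and le: "\<And>m. m \<in> A \<Longrightarrow> T m \<le> Max (T ` A)"
      by auto
    then obtain m where m: "m \<in> A" "\<And>j. j \<in> A \<Longrightarrow> T j \<le> T m"
      by auto
    have "T j \<le> t \<longleftrightarrow> T j \<le> T m" for j
      using m(1) m(2)[of j] by (cases "T j \<ge> 0") (auto simp: A_def)
    then have "jump_count h (T m) = k"
      using t(2) by (simp add: count)
    then show ?thesis
      using m(1) by (auto simp: A_def T_def)
  qed
next
  assume "(\<exists>n :: nat. jump_count h (real n) = k)
      \<or> (\<exists>m. (\<Sum>i\<le>m. h i) \<ge> 0 \<and> jump_count h (\<Sum>i\<le>m. h i) = k)"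
  then show "\<exists>t\<ge>0. jump_count h t = k"
    by (metis of_nat_0_le_iff)
qed

lemma sets_walk_stays:
  fixes E :: "'v::countable set set"
  shows "{\<omega> \<in> space (walk_space E). \<forall>t\<ge>0. random_walk x t \<omega> \<in> W} \<in> sets (walk_space E)"
proof -
  have walk_space: "walk_space E = jump_measure E UNIV \<Otimes>\<^sub>M holding_measure"
    by (simp add: walk_space_def)
  have [measurable]: "(\<lambda>\<omega>. jump_chain x (fst \<omega>) k) \<in> measurable (walk_space E) (count_space UNIV)" for k
    unfolding walk_space by (rule measurable_compose[OF measurable_fst measurable_undelayed_jump_chain])
  have [measurable]: "(\<lambda>\<omega>. \<Sum>i\<le>m. snd \<omega> i) \<in> borel_measurable (walk_space E)" for m :: nat
  proof -
    have "(\<lambda>h. h i) \<in> borel_measurable holding_measure" for i :: nat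
      using measurable_component_singleton[of i UNIV "\<lambda>_. density lborel (exponential_density 1)"]
      by (simp cong: measurable_cong_sets)
    then have "(\<lambda>h. \<Sum>i\<le>m. h i) \<in> borel_measurable holding_measure"
      by (rule borel_measurable_sum)
    then show ?thesis
      unfolding walk_space by (rule measurable_compose[OF measurable_snd])
  qed
  have [measurable]: "(\<lambda>\<omega>. jump_count (snd \<omega>) (u \<omega>)) \<in> measurable (walk_space E) (count_space UNIV)"
    if [measurable]: "u \<in> borel_measurable (walk_space E)" for u
    unfolding jump_count_def by measurable
  have "(\<forall>t\<ge>0. random_walk x t \<omega> \<in> W) \<longleftrightarrow>
      (\<forall>k. ((\<exists>n :: nat. jump_count (snd \<omega>) (real n) = k) \<or>
        (\<exists>m. (\<Sum>i\<le>m. snd \<omega> i) \<ge> 0 \<and> jump_count (snd \<omega>) (\<Sum>i\<le>m. snd \<omega> i) = k))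
        \<longrightarrow> jump_chain x (fst \<omega>) k \<in> W)" for \<omega>
    unfolding jump_count_attained_iff[symmetric] by (auto simp: random_walk_def case_prod_unfold)
  then show ?thesis by simp measurable
qed

text \<open>
  Whatever the holding times are, the walk only visits vertices of its jump chain.
\<close>

lemma walk_stays_ge_jump_chain_stays:
  fixes E :: "'v::countable set set"
  defines "M \<equiv> jump_measure E UNIV"
  shows "measure M {a \<in> space M. \<forall>k. jump_chain x a k \<in> W}
    \<le> measure (walk_space E) {\<omega> \<in> space (walk_space E). \<forall>t\<ge>0. random_walk x t \<omega> \<in> W}"
proof -
  interpret M: prob_space M
    unfolding M_def by (rule prob_space_jump_measure)
  interpret T: prob_space holding_measure
    by (rule prob_space_PiM) (simp add: prob_space_exponential_density)
  interpret MT: pair_prob_space M holding_measure ..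
  have walk_space: "walk_space E = M \<Otimes>\<^sub>M holding_measure"
    by (simp add: walk_space_def M_def)
  define A where "A = {a \<in> space M. \<forall>k. jump_chain x a k \<in> W}"
  have A: "A \<in> sets M"
  proof -
    have [measurable]: "(\<lambda>a. jump_chain x a k) \<in> measurable M (count_space UNIV)" for k
      unfolding M_def by (rule measurable_undelayed_jump_chain)
    show ?thesis unfolding A_def by measurable
  qed
  have "measure M A = measure (walk_space E) (A \<times> space holding_measure)"
    unfolding walk_space measure_def
    by (subst T.emeasure_pair_measure_Times[OF A]) (simp_all add: T.emeasure_space_1)
  also have "\<dots> \<le> measure (walk_space E) {\<omega> \<in> space (walk_space E). \<forall>t\<ge>0. random_walk x t \<omega> \<in> W}"
  proof -
    have "A \<times> space holding_measure
        \<subseteq> {\<omega> \<in> space (walk_space E). \<forall>t\<ge>0. random_walk x t \<omega> \<in> W}"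
      by (auto simp: A_def random_walk_def walk_space space_pair_measure)
    then show ?thesis
      using sets_walk_stays[of E x W] unfolding walk_space by (rule MT.finite_measure_mono)
  qed
  finally show ?thesis by (simp add: A_def)
qed

section \<open>Vertices where a signed harmonic function is almost maximal\<close>

text \<open>
  Along a path the gauge \<open>\<theta>\<close> picks up the product of the signs of the edges, and it returns to its
  nonzero initial value at the end of a closed path.
\<close>

lemma no_unsatisfied_cycle_if_gauge:
  fixes \<theta> :: "'v \<Rightarrow> real"
  assumes s: "s \<in> E \<rightarrow> {-1, 1}"
    and \<theta>: "\<And>x y. x \<in> W \<Longrightarrow> y \<in> W \<Longrightarrow> {x, y} \<in> E \<Longrightarrow> \<theta> y = of_int (s {x, y}) * \<theta> x"
    and nonzero: "\<And>x. x \<in> W \<Longrightarrow> \<theta> x \<noteq> 0"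
  shows "\<not> unsatisfied_cycle (induced_edges E W) s p"
proof
  assume cycle: "unsatisfied_cycle (induced_edges E W) s p"
  define n where "n = length p - 1"
  define N where "N k = {i. i < k \<and> s {p ! i, p ! Suc i} = -1}" for k
  have odd: "odd (card (N n))" and ends: "p ! 0 = p ! n"
    and edge: "\<And>i. i < n \<Longrightarrow> {p ! i, p ! Suc i} \<in> E \<and> p ! i \<in> W \<and> p ! Suc i \<in> W"
    using cycle
    by (auto simp: unsatisfied_cycle_def closed_path_def induced_edges_def N_def n_def hd_conv_nth last_conv_nth)
  have "\<theta> (p ! k) = (-1) ^ card (N k) * \<theta> (p ! 0)" if "k \<le> n" for k
    using that
  proof (induction k)
    case 0
    show ?case by (simp add: N_def)
  next
    case (Suc k)
    define e where "e = {p ! k, p ! Suc k}"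
    have step: "\<theta> (p ! Suc k) = of_int (s e) * \<theta> (p ! k)"
      using edge[of k] Suc.prems \<theta> by (auto simp: e_def)
    have "finite (N k)" "k \<notin> N k"
      by (simp_all add: N_def)
    moreover have "N (Suc k) = (if s e = -1 then insert k (N k) else N k)"
      by (auto simp: N_def e_def less_Suc_eq)
    moreover have "s e = 1 \<or> s e = -1"
      using edge[of k] Suc.prems s by (auto simp: e_def)
    ultimately show ?case
      using step Suc by auto
  qed
  from this[of n] have "\<theta> (p ! 0) = - \<theta> (p ! 0)"
    using odd ends by simp
  moreover have "n \<noteq> 0"
    using odd by (auto simp: N_def intro: ccontr)
  then have "\<theta> (p ! 0) \<noteq> 0"
    using edge[of 0] nonzero by blast
  ultimately show False by simp
qed

text \<open>
  If \<open>\<bar>h\<bar>\<close> is almost maximal at \<open>x\<close>, then no term of the average that equals \<open>h x\<close> can have the wrong sign: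
  the other terms are at most \<open>c\<close> in modulus, and \<open>\<bar>h x\<bar>\<close> would be at most \<open>c (1 - 1 / deg x)\<close>.
\<close>

lemma near_maximum_signs_agree:
  assumes E: "locally_finite_graph E" and s: "s \<in> E \<rightarrow> {-1, 1}"
    and deg_le: "deg E x \<le> D"
    and h: "signed_avg E s h x = h x" and h_le: "\<And>y. \<bar>h y\<bar> \<le> c"
    and x: "\<bar>h x\<bar> > c * (1 - 1 / D)" and y: "y \<in> nbrs E x"
  shows "sgn (h y) = of_int (s {x, y}) * sgn (h x) \<or> h y = 0"
proof (rule ccontr)
  define u where "u w = sgn (h x) * (of_int (s {x, w}) * h w)" for w
  assume neg: "\<not> (sgn (h y) = of_int (s {x, y}) * sgn (h x) \<or> h y = 0)"
  have d: "deg E x > 0" and fin: "finite (nbrs E x)"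
    using E by (simp_all add: deg_pos finite_nbrs)
  have "c \<ge> 0"
    using h_le[of x] by linarith
  have "u y \<le> 0"
    using neg sign_cases[OF s y] by (auto simp: u_def sgn_if split: if_splits)
  have u_le: "u w \<le> c" if "w \<in> nbrs E x" for w
    using sign_cases[OF s that] h_le[of w] \<open>c \<ge> 0\<close> by (auto simp: u_def sgn_if)
  have "deg E x * \<bar>h x\<bar> = sgn (h x) * (deg E x * signed_avg E s h x)"
    unfolding h by (simp add: abs_sgn)
  also have "\<dots> = (\<Sum>w\<in>nbrs E x. u w)"
    using d by (simp add: signed_avg_def u_def flip: sum_distrib_left)
  also have "\<dots> = u y + (\<Sum>w\<in>nbrs E x - {y}. u w)"
    by (rule sum.remove[OF fin y])
  also have "\<dots> \<le> 0 + (\<Sum>w\<in>nbrs E x - {y}. c)"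
    by (intro add_mono sum_mono) (auto intro: \<open>u y \<le> 0\<close> u_le)
  also have "\<dots> = (real (deg E x) - 1) * c"
    using fin y d by (simp add: deg_def of_nat_diff)
  finally have "\<bar>h x\<bar> \<le> c * (1 - 1 / deg E x)"
    using d by (simp add: field_simps)
  also have "\<dots> \<le> c * (1 - 1 / D)"
    using \<open>c \<ge> 0\<close> d deg_le by (intro mult_left_mono diff_left_mono frac_le) auto
  finally show False
    using x by linarith
qed

theorem proposition2:
  fixes E :: "'v::countable set set"
    and s :: "'v set \<Rightarrow> int"
    and S :: "real \<Rightarrow> (('v \<Rightarrow> bool) \<Rightarrow>\<^sub>C real) \<Rightarrow> (('v \<Rightarrow> bool) \<Rightarrow>\<^sub>C real)"
  assumes "locally_finite_graph E"
    and "bounded_degree E"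
    and "s \<in> E \<rightarrow> {-1, 1}"
    and "signed_voter_semigroup E s S"
    and "\<exists>\<mu> \<nu>. invariant_prob S \<mu> \<and> invariant_prob S \<nu> \<and> \<mu> \<noteq> \<nu>"
  shows "\<exists>W. (\<nexists>p. unsatisfied_cycle (induced_edges E W) s p) \<and>
           (\<exists>x\<in>W. measure (walk_space E)
              {\<omega> \<in> space (walk_space E). \<forall>t\<ge>0. random_walk x t \<omega> \<in> W} > 0)"
proof -
  note E = assms(1) and s = assms(3) and S = assms(4)
  obtain \<mu> \<nu> where \<mu>: "invariant_prob S \<mu>" and \<nu>: "invariant_prob S \<nu>" and "\<mu> \<noteq> \<nu>"
    using assms(5) by blast
  note probs = \<mu>[unfolded invariant_prob_def] \<nu>[unfolded invariant_prob_def]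
  define F where "F A = (\<integral>\<eta>. spin_product A \<eta> \<partial>\<mu>) - (\<integral>\<eta>. spin_product A \<eta> \<partial>\<nu>)" for A
  have F: "real (card B) * F B = (\<Sum>x\<in>B. signed_avg E s (\<lambda>y. F (annihilating_move B x y)) x)"
    if "finite B" for B
    using invariant_correlations[OF E s that S \<mu>] invariant_correlations[OF E s that S \<nu>]
    unfolding F_def signed_avg_diff sum_subtractf right_diff_distrib by simp
  have F_bound: "\<bar>F B\<bar> \<le> 2" for B
  proof -
    have "\<bar>\<integral>\<eta>. spin_product B \<eta> \<partial>M\<bar> \<le> 1" if "prob_space M" "sets M = sets borel" for M
    proof -
      interpret prob_space M by fact
      have "\<bar>\<integral>\<eta>. spin_product B \<eta> \<partial>M\<bar> \<le> (\<integral>\<eta>. \<bar>spin_product B \<eta>\<bar> \<partial>M)"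
        by (rule integral_abs_bound)
      then show ?thesis by (simp add: abs_spin_product prob_space)
    qed
    from this[of \<mu>] this[of \<nu>] show ?thesis
      unfolding F_def using probs by auto
  qed
  have "\<exists>A. finite A \<and> F A \<noteq> 0"
    using prob_eqI_spin_products[of \<mu> \<nu>] probs \<open>\<mu> \<noteq> \<nu>\<close> unfolding F_def by auto
  \<comment> \<open>By minimality of \<open>A\<close>, the function \<open>F\<close> does not see the sets that arise from \<open>A\<close> by an annihilation.\<close>
  then obtain A where A: "finite A" "F A \<noteq> 0"
    and min: "\<And>B. finite B \<and> F B \<noteq> 0 \<Longrightarrow> card A \<le> card B"
    using ex_has_least_nat[of "\<lambda>A. finite A \<and> F A \<noteq> 0" _ card] by blast
  have "F {} = 0"
    using probs by (simp add: F_def prob_space.prob_space)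
  then have "A \<noteq> {}"
    using A(2) by auto
  have F_small: "F B = 0" if "finite B" "card B < card A" for B
    using min[of B] that by (meson not_le)
  obtain h x0 c0 where h: "\<And>y. signed_avg E s h y = h y" and h_c0: "\<And>y. \<bar>h y\<bar> \<le> c0" and x0: "h x0 \<noteq> 0"
    using nonzero_signed_harmonic_exists[OF E s A(1) \<open>A \<noteq> {}\<close> F F_small F_bound A(2)] by metis

  define c where "c = (SUP y. \<bar>h y\<bar>)"
  have bdd: "bdd_above (range (\<lambda>y. \<bar>h y\<bar>))"
    using h_c0 by (intro bdd_aboveI[of _ c0]) auto
  have h_le: "\<bar>h y\<bar> \<le> c" for y
    unfolding c_def by (rule cSUP_upper[OF UNIV_I bdd])
  have "c > 0"
    using h_le[of x0] x0 by linarith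
  obtain D where D: "\<And>x. deg E x \<le> D"
    using assms(2) by (auto simp: bounded_degree_def bdd_above_def)
  have "D > 0"
    using D[of x0] deg_pos[OF E, of x0] by linarith
  define W where "W = {x. \<bar>h x\<bar> > c * (1 - 1 / D)}"
  have "c * (1 - 1 / D) < c"
    using \<open>c > 0\<close> \<open>D > 0\<close> by (simp add: field_simps)
  then obtain x where x: "x \<in> W"
    using less_cSUP_iff[OF _ bdd, of "c * (1 - 1 / D)"] unfolding c_def[symmetric] W_def by auto
  have "c * (1 - 1 / D) \<ge> 0"
    using \<open>c > 0\<close> \<open>D > 0\<close> by simp
  then have h_W: "h y \<noteq> 0" if "y \<in> W" for y
    using that by (auto simp: W_def)

  have "\<not> unsatisfied_cycle (induced_edges E W) s p" for p
  proof (rule no_unsatisfied_cycle_if_gauge[OF s, where \<theta> = "\<lambda>x. sgn (h x)"])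
    fix u v assume uv: "u \<in> W" "v \<in> W" "{u, v} \<in> E"
    have "v \<in> nbrs E u"
      using uv(3) by (simp add: nbrs_def)
    then show "sgn (h v) = of_int (s {u, v}) * sgn (h u)"
      using near_maximum_signs_agree[OF E s D h h_le, of u v] h_W[OF uv(2)] uv(1) by (simp add: W_def)
  qed (simp add: h_W sgn_zero_iff)
  moreover
  \<comment> \<open>The function \<open>\<bar>h\<bar>\<close> is subharmonic; \<open>g\<close> is the distance to its supremum, scaled to be at least \<open>1\<close> exactly outside \<open>W\<close>.\<close>
  define g where "g y = (c - \<bar>h y\<bar>) * (D / c)" for y
  have "avg E g y \<le> g y" for y
  proof -
    have "avg E g y = avg E (\<lambda>w. D / c * (c - \<bar>h w\<bar>)) y"
      by (simp add: g_def[abs_def] mult.commute)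
    also have "\<dots> = D / c * (c - avg E (\<lambda>w. \<bar>h w\<bar>) y)"
      unfolding signed_avg_scale signed_avg_diff avg_const[OF E] ..
    also have "\<dots> \<le> D / c * (c - \<bar>h y\<bar>)"
      using abs_signed_avg_le[OF s, of h y] \<open>c > 0\<close> unfolding h by (intro mult_left_mono) auto
    finally show ?thesis by (simp add: g_def mult.commute)
  qed
  moreover have "g y \<ge> 0" for y
    using h_le[of y] \<open>c > 0\<close> by (simp add: g_def)
  moreover have W_iff: "y \<in> W \<longleftrightarrow> g y < 1" for y
    using \<open>c > 0\<close> \<open>D > 0\<close> by (simp add: W_def g_def field_simps)
  ultimately have "0 < measure (walk_space E) {\<omega> \<in> space (walk_space E). \<forall>t\<ge>0. random_walk x t \<omega> \<in> W}"
    using stay_forever_probability_ge[OF E, of W g x] walk_stays_ge_jump_chain_stays[of E x W] x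
    by (smt (verit))
  with \<open>\<And>p. \<not> unsatisfied_cycle (induced_edges E W) s p\<close> x show ?thesis
    by blast
qed

end
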